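(* Let $r\in[0,\mu_D)$. The relative value function $v_r:\mathbb{R}_+\to\mathbb{R}$ of the constant order policy, characterized by $$v_r(x)=a_r(x)+\int_{-r}^{x}v_r(x-y)\,F_Y(dy),\qquad v_r(0)=0,\ x\ge 0,$$ is given by $$v_r(x)=\frac{h\mu_+}{\mu_D-r}\int_0^x U_+(y)\,dy-(h+p)x,\qquad x\ge 0.$$
   Context: $D$ is a non-negative random variable (demand per period) with distribution function $F_D$ supported on $[0,\infty)$, $F_D(0)=0$, finite mean $\mu_D$ and variance $\sigma_D^2\in(0,\infty)$; $\{D_t\}$ are i.i.d. copies. $h\ge 0$ is the unit holding cost and $p\ge 0$ the unit lost sales penalty cost; $(x)^+=\max(x,0)$. For $r\in[0,\mu_D)$ let $Y=D-r$, with distribution function $F_Y$ and mean $\mu_Y=\mu_D-r>0$, and $$a_r(x)=h\,\mathbb{E}[(x-Y)^+]+p\,\mathbb{E}[(Y-x)^+]-p\mu_Y-h\,\mathbb{E}[J_\infty],$$ where $J_\infty$ has the steady-state distribution of the recursion $J_{t+1}=(J_t+r-D_t)^+$, $J_0=0$ (inventory level when the constant quantity $r$ is received every period), i.e. $\mathbb{P}\{J_\infty\le x\}=\lim_{t\to\infty}\mathbb{P}\{J_t\le x\}$. The equation $v_r(x)=a_r(x)+\int_{-r}^{x}v_r(x-y)\,F_Y(dy)$, $v_r(0)=0$, $x\ge 0$, is equivalent to the average-cost relative value equation $v_r(x)=\mathbb{E}[h(x-Y)^++p(Y-x)^++v_r((x-Y)^+)]-\mathcal{C}(C_r)$, $v_r(0)=0$,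 $x\ge0$, where $\mathcal{C}(C_r)=h\,\mathbb{E}[J_\infty]+p\mu_Y$ is the long-run average cost of the constant order policy $C_r$. Ladder quantities: let $Y_t=D_t-r$, $S_0=0$, $S_t=\sum_{i=1}^tY_i$, $\tau_+=\inf\{t>0:S_t\ge0\}$ (weak ascending ladder period), $G_+(x)=\mathbb{P}\{S_{\tau_+}\le x\}$, $\mu_+=\mathbb{E}[S_{\tau_+}]$. The ascending ladder height renewal measure is $U_+(x)=\sum_{t=0}^\infty G_+^{*t}(x)$, where $G_+^{*t}$ is the $t$-fold convolution of $G_+$ and $G_+^{*0}$ is the distribution function of the unit mass at $0$.
   Formalization: The equation with v_r(0)=0 alone does not determine v_r (e.g. exponential D, r>0), so the characterization is stated among functions growing slower than every exponential, with the integral in the equation required to exist; the formula is shown to solve the equation and lie in this class. *)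

theory Defs
  imports "HOL-Probability.Probability"
begin

text \<open>
  Throughout, \<open>M\<close> is a probability space, \<open>D\<close> the generic demand, \<open>Dt\<close> the demand sequence,
  \<open>h\<close> and \<open>p\<close> the unit holding and lost sales penalty costs, and \<open>r\<close> the constant order quantity.
\<close>

definition net_demand_law :: "'a measure \<Rightarrow> ('a \<Rightarrow> real) \<Rightarrow> real \<Rightarrow> real measure" where
  "net_demand_law M D r = distr M borel (\<lambda>\<omega>. D \<omega> - r)"

primrec inventory :: "(nat \<Rightarrow> 'a \<Rightarrow> real) \<Rightarrow> real \<Rightarrow> nat \<Rightarrow> 'a \<Rightarrow> real" where
  "inventory Dt r 0 \<omega> = 0"
| "inventory Dt r (Suc t) \<omega> = max (inventory Dt r t \<omega> + r - Dt t \<omega>) 0"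

text \<open>
  The law of \<open>J\<^sub>\<infinity>\<close>, as the Lebesgue--Stieltjes measure of the pointwise limit of the
  distribution functions of the \<open>J\<^sub>t\<close>. For i.i.d. demand with \<open>0 \<le> r < \<mu>\<^sub>D\<close> the limit exists
  for every \<open>x\<close> (the \<open>J\<^sub>t\<close> increase stochastically) and is a distribution function.
\<close>

definition steady_state_law :: "'a measure \<Rightarrow> (nat \<Rightarrow> 'a \<Rightarrow> real) \<Rightarrow> real \<Rightarrow> real measure" where
  "steady_state_law M Dt r =
     interval_measure (\<lambda>x. lim (\<lambda>t. measure M {\<omega> \<in> space M. inventory Dt r t \<omega> \<le> x}))"

definition relative_cost ::
  "'a measure \<Rightarrow> ('a \<Rightarrow> real) \<Rightarrow> (nat \<Rightarrow> 'a \<Rightarrow> real) \<Rightarrow> real \<Rightarrow> real \<Rightarrow> real \<Rightarrow> real \<Rightarrow> real" where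
  "relative_cost M D Dt h p r x =
     h * (\<integral>y. max (x - y) 0 \<partial>net_demand_law M D r)
     + p * (\<integral>y. max (y - x) 0 \<partial>net_demand_law M D r)
     - p * (\<integral>y. y \<partial>net_demand_law M D r)
     - h * (\<integral>j. j \<partial>steady_state_law M Dt r)"

text \<open>
  Only the values of \<open>v\<close> on \<open>[0,\<infinity>)\<close> matter: for \<open>y \<in> [-r,x]\<close> the argument \<open>x - y\<close> lies in
  \<open>[0,x + r]\<close>. Integrability is explicit because a Bochner integral is \<open>0\<close> otherwise.
\<close>

definition solves_relative_value_equation ::
  "'a measure \<Rightarrow> ('a \<Rightarrow> real) \<Rightarrow> (nat \<Rightarrow> 'a \<Rightarrow> real) \<Rightarrow> real \<Rightarrow> real \<Rightarrow> real \<Rightarrow> (real \<Rightarrow> real) \<Rightarrow> bool" where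
  "solves_relative_value_equation M D Dt h p r v \<longleftrightarrow>
     v 0 = 0 \<and>
     (\<forall>x\<ge>0. set_integrable (net_demand_law M D r) {-r..x} (\<lambda>y. v (x - y)) \<and>
        v x = relative_cost M D Dt h p r x + (LINT y:{-r..x}|net_demand_law M D r. v (x - y)))"

text \<open>
  When \<open>P(D < r) > 0\<close>, the equation alone need not determine \<open>v\<close>. For instance, for exponential
  demand with rate \<open>\<lambda>\<close> and \<open>r > 0\<close>, its homogeneous version is
  \<open>w' x = \<lambda> * (w (x + r) - w x)\<close> together with one linear condition on the restriction of \<open>w\<close>
  to \<open>[0,r]\<close>; every smooth function with compact support in \<open>(0,r)\<close> satisfying that condition
  extends step by step to a solution with \<open>w 0 = 0\<close>. The following growth condition
  excludes such spurious solutions; it allows every function bounded by a polynomial on \<open>[0,\<infinity>)\<close>.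
\<close>

definition subexponential :: "(real \<Rightarrow> real) \<Rightarrow> bool" where
  "subexponential v \<longleftrightarrow> (\<forall>\<epsilon>>0. \<exists>K. \<forall>x\<ge>0. \<bar>v x\<bar> \<le> K * exp (\<epsilon> * x))"

definition partial_sum :: "(nat \<Rightarrow> 'a \<Rightarrow> real) \<Rightarrow> real \<Rightarrow> nat \<Rightarrow> 'a \<Rightarrow> real" where
  "partial_sum Dt r t \<omega> = (\<Sum>i=1..t. (Dt i \<omega> - r))"

text \<open>
  The infimum of the empty set is \<open>0\<close> here rather than \<open>\<infinity>\<close>; for \<open>r < \<mu>\<^sub>D\<close> the walk drifts to
  \<open>\<infinity>\<close>, so the set is empty only on a null event.
\<close>

definition ladder_period :: "(nat \<Rightarrow> 'a \<Rightarrow> real) \<Rightarrow> real \<Rightarrow> 'a \<Rightarrow> nat" where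
  "ladder_period Dt r \<omega> = Inf {t. 0 < t \<and> 0 \<le> partial_sum Dt r t \<omega>}"

definition ladder_height :: "(nat \<Rightarrow> 'a \<Rightarrow> real) \<Rightarrow> real \<Rightarrow> 'a \<Rightarrow> real" where
  "ladder_height Dt r \<omega> = partial_sum Dt r (ladder_period Dt r \<omega>) \<omega>"

definition ladder_height_law :: "'a measure \<Rightarrow> (nat \<Rightarrow> 'a \<Rightarrow> real) \<Rightarrow> real \<Rightarrow> real measure" where
  "ladder_height_law M Dt r = distr M borel (ladder_height Dt r)"

primrec convolution_power :: "real measure \<Rightarrow> nat \<Rightarrow> real measure" where
  "convolution_power G 0 = return borel 0"
| "convolution_power G (Suc t) = convolution G (convolution_power G t)"

definition renewal_function :: "'a measure \<Rightarrow> (nat \<Rightarrow> 'a \<Rightarrow> real) \<Rightarrow> real \<Rightarrow> real \<Rightarrow> real" where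
  "renewal_function M Dt r x = (\<Sum>t. cdf (convolution_power (ladder_height_law M Dt r) t) x)"

end

theory Submission
  imports Defs "HOL-Real_Asymp.Real_Asymp"
begin

text \<open>
  Write \<open>U\<close> for the renewal function of the ladder heights and \<open>W x\<close> for its integral over \<open>[0,x]\<close>.
  A Wiener--Hopf argument identifies \<open>U\<close> with the occupation function of the walk killed on
  entering \<open>(-\<infinity>,0)\<close>, so the Markov property gives \<open>U x = \<kappa> + E U(x - Y)\<close> for \<open>x \<ge> 0\<close> with a
  constant \<open>\<kappa>\<close>. Dynkin's formula up to the ladder period, applied to \<open>s \<mapsto> U(-s)\<close> and to the
  identity, shows \<open>\<kappa> = \<mu>\<^sub>Y / \<mu>\<^sub>+\<close>. Integrating, \<open>E W((x - Y)\<^sup>+) = W x + C - \<kappa> x\<close>, and evaluating this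
  along the inventory recursion, where \<open>E W(J\<^sub>t)\<close> converges, yields \<open>C = \<kappa> E J\<^sub>\<infinity>\<close>. Hence
  \<open>(h / \<kappa>) W x - (h + p) x\<close> solves the equation. It is the only subexponential solution because
  \<open>E exp(-\<epsilon> Y) < 1\<close> for small \<open>\<epsilon> > 0\<close>, which makes the homogeneous equation a contraction in an
  exponentially weighted norm.
\<close>

text \<open>One estimate does four jobs. Demand is nonnegative, so Y \<ge> -r, and with a positive
  mean and a second moment this yields \<open>laplace \<epsilon> < 1\<close> for arbitrarily small
  \<epsilon> > 0. It makes the occupation measures of the killed walks finite on half-lines, bounds
  the tail of the ladder period geometrically, gives all J_t a common exponential moment, and forces
  uniqueness. Identities are stated in \<open>ennreal\<close> with every term added rather than
  subtracted, so that Fubini and monotone convergence apply freely; a term is cancelled only after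
  it is known to be finite. The constant \<kappa> appears as \<open>1 - undershoot\<close>, the
  probability that the walk never enters (-\<infinity>,0). It is linked to the ladder heights
  through \<open>total\<close>, the mean ladder period. Because ladder epochs are weak, one killed
  walk must stay in \<open>{0..}\<close> and the other in \<open>{..<0}\<close>: the two sets
  partition the line, and a step leaving one lands in the other.\<close>

text \<open>The walk with step law \<open>F\<close>, killed at the first time \<open>n \<ge> 1\<close> at which it is outside \<open>A\<close>.\<close>

primrec killed_law :: "real measure \<Rightarrow> real set \<Rightarrow> nat \<Rightarrow> real measure" where
  "killed_law F A 0 = return borel 0"
| "killed_law F A (Suc n) = density (killed_law F A n \<star> F) (indicator A)"

lemma sets_killed_law [simp, measurable_cong]: "sets (killed_law F A n) = sets borel"
  by (cases n) auto

lemma space_killed_law [simp]: "space (killed_law F A n) = UNIV"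
  by (cases n) auto

text \<open>For t < 0 the quadratic Taylor lower bound for exp(-t), multiplied by 1 + t + t^2, gives
  1 + t^2/2 - t^3/2 + t^4/2 \<ge> 1. The range t \<le> 1 contains \<open>- \<epsilon> * y\<close>
  whenever y \<ge> -r and \<epsilon> r \<le> 1, so a second moment of the step controls its Laplace
  transform.\<close>

lemma exp_le_quadratic:
  fixes t :: real
  assumes "t \<le> 1"
  shows "exp t \<le> 1 + t + t\<^sup>2"
proof (cases "0 \<le> t")
  case True
  then show ?thesis using exp_bound[of t] assms by simp
next
  case False
  then have "1 / exp t = exp (-t)" by (simp add: exp_minus divide_inverse)
  moreover have "exp (-t) \<ge> 1 + (-t) + (-t)\<^sup>2 / 2"
    using exp_lower_Taylor_quadratic[of "-t"] False by simp
  moreover have "(1 + t + t\<^sup>2) * (1 - t + t\<^sup>2/2) \<ge> 1"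
  proof -
    have "(1 + t + t\<^sup>2) * (1 - t + t\<^sup>2/2) = 1 + t\<^sup>2 / 2 - t ^ 3 / 2 + t^4 / 2"
      by (simp add: field_simps power2_eq_square power3_eq_cube power4_eq_xxxx)
    moreover have "t^3 \<le> 0" using False by (simp add: power_le_zero_eq)
    moreover have "t^4 \<ge> 0" "t\<^sup>2 \<ge> 0" by simp_all
    ultimately show ?thesis by linarith
  qed
  moreover have "0 \<le> 1 + t + t\<^sup>2"
    using sum_power2_ge_zero[of "1 + t" t] sum_power2_ge_zero[of 1 t]
    by (simp add: power2_eq_square algebra_simps)
  ultimately have "1 \<le> (1 + t + t\<^sup>2) * exp (-t)"
    by (smt (verit) mult_left_mono power2_minus)
  then show ?thesis by (simp add: exp_minus field_simps)
qed

text \<open>The law of J_t: the new step is an independent copy of Y, so the inventory recursion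
  becomes a recursion of measures that mentions no sample space.\<close>

primrec lindley :: "real measure \<Rightarrow> nat \<Rightarrow> real measure" where
  "lindley F 0 = return borel 0"
| "lindley F (Suc t) = distr (lindley F t \<Otimes>\<^sub>M F) borel (\<lambda>(s, y). max (s - y) 0)"

lemma sets_lindley [simp, measurable_cong]: "sets (lindley F t) = sets borel"
  by (cases t) auto

lemma space_lindley [simp]: "space (lindley F t) = UNIV"
  by (cases t) auto

section \<open>Nonnegative double series and the tail formula for the mean\<close>

lemma ennreal_suminf_swap:
  fixes f :: "nat \<Rightarrow> nat \<Rightarrow> ennreal"
  shows "(\<Sum>n. \<Sum>i. f n i) = (\<Sum>i. \<Sum>n. f n i)"
  using nn_integral_suminf[of "\<lambda>i n. f n i" "count_space UNIV"]
  by (simp add: nn_integral_count_space_nat)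

text \<open>The left side runs through the pairs along the antidiagonals i + k = n. This turns a
  factorisation graded by the number of steps into two independent sums.\<close>

lemma ennreal_suminf_triangle:
  fixes c :: "nat \<Rightarrow> nat \<Rightarrow> ennreal"
  shows "(\<Sum>n. \<Sum>i<Suc n. c i (n - i)) = (\<Sum>i. \<Sum>k. c i k)"
proof -
  have "(\<Sum>i<Suc n. c i (n - i)) = (\<Sum>i. if i \<le> n then c i (n - i) else 0)" for n
    by (subst suminf_finite[of "{..<Suc n}"]) (auto intro!: sum.cong)
  moreover have "(\<Sum>n. if i \<le> n then c i (n - i) else 0) = (\<Sum>k. c i k)" for i
    by (subst suminf_offset[of _ i]) auto
  ultimately show ?thesis by (simp add: ennreal_suminf_swap[of "\<lambda>n i. if i \<le> n then c i (n - i) else 0"])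
qed

lemma ennreal_suminf_head:
  fixes f :: "nat \<Rightarrow> ennreal"
  shows "suminf f = (\<Sum>n. f (Suc n)) + f 0"
  using suminf_offset[of f 1] by simp

text \<open>\<open>ennreal s\<close> is the length of [0,s); a negative s contributes zero on both
  sides. It reduces convergence of means to convergence of distribution functions.\<close>

lemma nn_integral_layer_cake:
  fixes M :: "real measure"
  assumes "sigma_finite_measure M" and [measurable_cong]: "sets M = sets borel"
  shows "(\<integral>\<^sup>+s. ennreal s \<partial>M) = (\<integral>\<^sup>+x. indicator {0..} x * emeasure M {x<..} \<partial>lborel)"
proof -
  interpret M: sigma_finite_measure M by fact
  interpret P: pair_sigma_finite M lborel ..
  have "ennreal s = (\<integral>\<^sup>+x. indicator {0..} x * indicator {x<..} s \<partial>lborel)" for s :: real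
  proof -
    have "(\<integral>\<^sup>+x. indicator {0..} x * indicator {x<..} s \<partial>lborel) = (\<integral>\<^sup>+x. indicator {0..<s} x \<partial>lborel)"
      by (intro nn_integral_cong) (auto simp: indicator_def)
    also have "\<dots> = ennreal s"
      by (cases "0 \<le> s") (simp_all add: ennreal_neg)
    finally show ?thesis by simp
  qed
  then have "(\<integral>\<^sup>+s. ennreal s \<partial>M) = (\<integral>\<^sup>+s. \<integral>\<^sup>+x. indicator {0..} x * indicator {x<..} s \<partial>lborel \<partial>M)"
    by simp
  also have "\<dots> = (\<integral>\<^sup>+x. \<integral>\<^sup>+s. indicator {0..} x * indicator {x<..} s \<partial>M \<partial>lborel)"
  proof (rule P.Fubini'[symmetric])
    have "Measurable.pred (borel \<Otimes>\<^sub>M borel) (\<lambda>p :: real \<times> real. fst p < snd p)" by measurable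
    then have [measurable]: "{p :: real \<times> real. fst p < snd p} \<in> sets (borel \<Otimes>\<^sub>M borel)"
      by (simp add: pred_def space_pair_measure)
    have eq: "indicator {x<..} s = (indicator {p :: real \<times> real. fst p < snd p} (x, s) :: ennreal)" for x s :: real
      by (simp add: indicator_def)
    show "(\<lambda>(s, x). indicator {0..} x * indicator {x<..} s :: ennreal) \<in> borel_measurable (M \<Otimes>\<^sub>M lborel)"
      unfolding split_beta' eq by measurable
  qed
  also have "\<dots> = (\<integral>\<^sup>+x. indicator {0..} x * emeasure M {x<..} \<partial>lborel)"
    by (intro nn_integral_cong) (simp add: nn_integral_cmult assms(2))
  finally show ?thesis .
qed

section \<open>The random walk with step law \<open>F\<close>\<close>

locale net_demand = real_distribution F for F :: "real measure" +
  fixes r :: real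
  assumes r_nonneg: "0 \<le> r"
    and bounded_below: "AE y in F. - r \<le> y"
    and integrable_id: "integrable F (\<lambda>y. y)"
    and integrable_square: "integrable F (\<lambda>y. y\<^sup>2)"
    and mean_pos: "0 < (\<integral>y. y \<partial>F)"
begin

definition mu :: real where "mu = (\<integral>y. y \<partial>F)"

definition laplace :: "real \<Rightarrow> real" where "laplace \<epsilon> = (\<integral>y. exp (- \<epsilon> * y) \<partial>F)"

lemma integrable_exp: "0 \<le> \<epsilon> \<Longrightarrow> integrable F (\<lambda>y. exp (- \<epsilon> * y))"
proof (rule integrable_const_bound[where B = "exp (\<epsilon> * r)"])
  assume "0 \<le> \<epsilon>"
  show "AE y in F. norm (exp (- \<epsilon> * y)) \<le> exp (\<epsilon> * r)"
    using bounded_below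
  proof eventually_elim
    case (elim y)
    then show ?case using mult_left_mono[OF elim \<open>0 \<le> \<epsilon>\<close>] by simp
  qed
qed simp

lemma laplace_nonneg: "0 \<le> laplace \<epsilon>"
  unfolding laplace_def by (intro integral_nonneg_AE) simp

lemma nn_integral_exp: "0 \<le> \<epsilon> \<Longrightarrow> (\<integral>\<^sup>+y. ennreal (exp (- \<epsilon> * y)) \<partial>F) = ennreal (laplace \<epsilon>)"
  unfolding laplace_def by (intro nn_integral_eq_integral integrable_exp) auto

text \<open>Integrating 1 - \<epsilon> y + \<epsilon>^2 y^2 bounds the transform by 1 - \<epsilon>
  mu + \<epsilon>^2 E Y^2. Placing \<epsilon> below any given \<delta> is what later makes the value
  function subexponential and not merely exponentially bounded.\<close>

lemma laplace_lt_1: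
  assumes "0 < \<delta>"
  obtains \<epsilon> where "0 < \<epsilon>" "\<epsilon> < \<delta>" "laplace \<epsilon> < 1"
proof -
  define s where "s = (\<integral>y. y\<^sup>2 \<partial>F)"
  have s: "0 \<le> s" unfolding s_def by (intro integral_nonneg_AE) simp
  have m: "0 < mu" using mean_pos by (simp add: mu_def)
  \<comment> \<open>The three bounds serve, in turn, \<epsilon> < \<delta>, the exponent bound
    -\<epsilon> y \<le> 1 on y \<ge> -r, and \<epsilon> E Y^2 < mu, by which the linear term wins;
    the \<open>+ 1\<close> avoids division by zero.\<close>
  define \<epsilon> where "\<epsilon> = min (\<delta> / 2) (min (1 / (r + 1)) (mu / (s + 1) / 2))"
  have e: "0 < \<epsilon>" "\<epsilon> < \<delta>" "\<epsilon> \<le> 1 / (r + 1)" "\<epsilon> \<le> mu / (s + 1) / 2"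
    using assms m s r_nonneg unfolding \<epsilon>_def by auto
  have er: "\<epsilon> * r \<le> 1" using e(1,3) r_nonneg by (simp add: field_simps)
  have "laplace \<epsilon> \<le> (\<integral>y. 1 - \<epsilon> * y + \<epsilon>\<^sup>2 * y\<^sup>2 \<partial>F)"
    unfolding laplace_def
  proof (rule integral_mono_AE)
    show "AE y in F. exp (- \<epsilon> * y) \<le> 1 - \<epsilon> * y + \<epsilon>\<^sup>2 * y\<^sup>2"
      using bounded_below
    proof eventually_elim
      case (elim y)
      then have "- \<epsilon> * y \<le> 1"
        using mult_left_mono[OF elim less_imp_le[OF e(1)]] er by simp
      then show ?case using exp_le_quadratic[of "- \<epsilon> * y"] by (simp add: power_mult_distrib)
    qed
  qed (use e integrable_id integrable_square integrable_exp[of \<epsilon>] in auto)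
  also have "\<dots> = 1 - \<epsilon> * mu + \<epsilon>\<^sup>2 * s"
    unfolding mu_def s_def using integrable_id integrable_square by (simp add: prob_space[simplified])
  also have "\<dots> < 1"
  proof -
    have "\<epsilon> * (s + 1) \<le> mu / 2" using e(4) s by (simp add: field_simps)
    then have "\<epsilon> * s < mu" using e(1) m by (simp add: algebra_simps)
    then have "\<epsilon> * (\<epsilon> * s) < \<epsilon> * mu" using e(1) by simp
    then show ?thesis by (simp add: power2_eq_square mult.assoc)
  qed
  finally show ?thesis using e that by blast
qed

section \<open>Killed walks: total mass and exponential weights\<close>

text \<open>Killing cannot add mass. The claim covers every set \<open>A\<close>, measurable or not,
  so that the sublocale below carries no side condition on \<open>A\<close>.\<close>

lemma killed_law_finite: "emeasure (killed_law F A n) UNIV \<le> 1 \<and> finite_measure (killed_law F A n)"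
proof (induction n)
  case 0
  show ?case
    using prob_space.finite_measure[OF prob_space_return[of "0::real" borel]] by simp
next
  case (Suc n)
  then have fin: "finite_measure (killed_law F A n)" by simp
  have FF: "finite_measure F" by unfold_locales
  have "emeasure (killed_law F A (Suc n)) UNIV \<le> emeasure (killed_law F A n \<star> F) UNIV"
  proof -
    have "(\<integral>\<^sup>+x. indicator A x \<partial>(killed_law F A n \<star> F)) \<le> (\<integral>\<^sup>+x. 1 \<partial>(killed_law F A n \<star> F))"
      by (intro nn_integral_mono) (auto simp: indicator_def)
    moreover have "emeasure (killed_law F A (Suc n)) UNIV \<le> (\<integral>\<^sup>+x. indicator A x \<partial>(killed_law F A n \<star> F))"
    proof (cases "(indicator A :: real \<Rightarrow> ennreal) \<in> borel_measurable borel")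
      case True
      then show ?thesis by (simp add: emeasure_density)
    next
      case False
      \<comment> \<open>With a non-measurable density the construction yields either the defining
        integral or zero; the bound holds in both cases.\<close>
      then show ?thesis unfolding killed_law.simps density_def by (simp add: emeasure_measure_of_conv)
    qed
    ultimately show ?thesis by simp
  qed
  also have "\<dots> = (\<integral>\<^sup>+s. \<integral>\<^sup>+y. 1 \<partial>F \<partial>killed_law F A n)"
    by (subst convolution_emeasure'[OF _ fin FF]) auto
  also have "\<dots> \<le> 1" using Suc emeasure_space_1 by simp
  finally have *: "emeasure (killed_law F A (Suc n)) UNIV \<le> 1" .
  then have "emeasure (killed_law F A (Suc n)) (space (killed_law F A (Suc n))) \<noteq> \<infinity>"
    unfolding space_killed_law by (auto simp: top_unique)
  then show ?case using * by (simp add: finite_measureI)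
qed

end

sublocale net_demand \<subseteq> killed: finite_measure "killed_law F A n" for A n
  using killed_law_finite by simp

context net_demand
begin

lemma nn_integral_killed_law_Suc:
  assumes [measurable]: "A \<in> sets borel" "f \<in> borel_measurable borel"
  shows "(\<integral>\<^sup>+x. f x \<partial>killed_law F A (Suc n)) =
    (\<integral>\<^sup>+s. \<integral>\<^sup>+y. f (s + y) * indicator A (s + y) \<partial>F \<partial>killed_law F A n)"
proof -
  have "(\<integral>\<^sup>+x. f x \<partial>killed_law F A (Suc n)) = (\<integral>\<^sup>+x. f x * indicator A x \<partial>(killed_law F A n \<star> F))"
    by (simp add: nn_integral_density mult.commute)
  also have "\<dots> = (\<integral>\<^sup>+s. \<integral>\<^sup>+y. f (s + y) * indicator A (s + y) \<partial>F \<partial>killed_law F A n)"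
    by (rule nn_integral_convolution) (auto intro: killed.finite_measure_axioms finite_measure_axioms)
  finally show ?thesis .
qed

lemma AE_killed_law:
  assumes [measurable]: "A \<in> sets borel" and "0 < n"
  shows "AE s in killed_law F A n. s \<in> A"
proof -
  obtain m where "n = Suc m" using \<open>0 < n\<close> by (cases n) auto
  show ?thesis unfolding \<open>n = Suc m\<close> killed_law.simps
    by (subst AE_density) (auto simp: indicator_def)
qed

text \<open>The weight exp(-\<epsilon> s) is multiplicative along independent steps and killing only
  discards mass, so every step contributes at most the factor
  \<open>laplace \<epsilon>\<close>.\<close>

lemma killed_law_laplace:
  assumes [measurable]: "A \<in> sets borel" and "0 \<le> \<epsilon>"
  shows "(\<integral>\<^sup>+s. ennreal (exp (- \<epsilon> * s)) \<partial>killed_law F A n) \<le> ennreal (laplace \<epsilon> ^ n)"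
proof (induction n)
  case 0
  show ?case by (simp add: nn_integral_return)
next
  case (Suc n)
  have "(\<integral>\<^sup>+s. ennreal (exp (- \<epsilon> * s)) \<partial>killed_law F A (Suc n))
      \<le> (\<integral>\<^sup>+s. \<integral>\<^sup>+y. ennreal (exp (- \<epsilon> * s)) * ennreal (exp (- \<epsilon> * y)) \<partial>F \<partial>killed_law F A n)"
    by (subst nn_integral_killed_law_Suc, measurable)
      (intro nn_integral_mono, auto simp: indicator_def algebra_simps exp_add[symmetric] ennreal_mult'[symmetric])
  also have "\<dots> = (\<integral>\<^sup>+s. ennreal (exp (- \<epsilon> * s)) \<partial>killed_law F A n) * ennreal (laplace \<epsilon>)"
    using nn_integral_exp[OF assms(2)] by (simp add: nn_integral_cmult nn_integral_multc)
  also have "\<dots> \<le> ennreal (laplace \<epsilon> ^ n) * ennreal (laplace \<epsilon>)"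
    by (intro mult_right_mono Suc) simp
  finally show ?case by (simp add: ennreal_mult'[symmetric] laplace_nonneg mult.commute)
qed

lemma suminf_killed_law_laplace:
  assumes "A \<in> sets borel" "0 \<le> \<epsilon>" "laplace \<epsilon> < 1"
  shows "(\<Sum>n. \<integral>\<^sup>+s. ennreal (exp (- \<epsilon> * s)) \<partial>killed_law F A n) \<le> ennreal (1 / (1 - laplace \<epsilon>))"
proof -
  have "(\<Sum>n. \<integral>\<^sup>+s. ennreal (exp (- \<epsilon> * s)) \<partial>killed_law F A n) \<le> (\<Sum>n. ennreal (laplace \<epsilon> ^ n))"
    by (intro suminf_le killed_law_laplace assms) auto
  also have "\<dots> = ennreal (\<Sum>n. laplace \<epsilon> ^ n)"
    by (intro suminf_ennreal2 summable_geometric) (auto simp: laplace_nonneg assms(3))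
  finally show ?thesis by (simp add: suminf_geometric laplace_nonneg assms(3))
qed

section \<open>The occupation function of the walk killed below zero\<close>

text \<open>Defined by the killed walk alone, before ladder heights appear;
  \<open>suminf_cdf_convolution_power\<close> shows that it is U_+. By
  \<open>ennreal_renewal\<close> the series is finite, so \<open>enn2real\<close> loses
  nothing.\<close>

definition renewal :: "real \<Rightarrow> real" where
  "renewal x = enn2real (\<Sum>n. emeasure (killed_law F {0..} n) {..x})"

lemma AE_pos: "AE s in killed_law F {0..} n. 0 \<le> s"
proof (cases n)
  case 0
  show ?thesis unfolding 0 killed_law.simps by (subst AE_return) simp_all
next
  case (Suc m)
  then show ?thesis using AE_killed_law[of "{0..}" n] by simp
qed

lemma AE_neg: "AE s in killed_law F {..<0} n. s \<le> 0"
proof (cases n)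
  case 0
  show ?thesis unfolding 0 killed_law.simps by (subst AE_return) simp_all
next
  case (Suc m)
  then have "AE s in killed_law F {..<0} n. s < 0" using AE_killed_law[of "{..<0}" n] by simp
  then show ?thesis by eventually_elim simp
qed

lemma emeasure_killed_law_atMost:
  "emeasure (killed_law F A n) {..x} = (\<integral>\<^sup>+s. indicator {..x} s \<partial>killed_law F A n)"
  by simp

text \<open>Chernoff: the indicator of s \<le> x is at most exp(\<epsilon> (x - s)).\<close>

lemma suminf_killed_law_atMost:
  assumes "0 < \<epsilon>" "laplace \<epsilon> < 1" "A \<in> sets borel"
  shows "(\<Sum>n. emeasure (killed_law F A n) {..x}) \<le> ennreal (exp (\<epsilon> * x) / (1 - laplace \<epsilon>))"
proof -
  have "emeasure (killed_law F A n) {..x}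
      \<le> ennreal (exp (\<epsilon> * x)) * (\<integral>\<^sup>+s. ennreal (exp (- \<epsilon> * s)) \<partial>killed_law F A n)" for n
    by (subst emeasure_killed_law_atMost, subst nn_integral_cmult[symmetric], simp, rule nn_integral_mono)
      (use assms(1) in \<open>auto simp: indicator_def ennreal_mult'[symmetric] exp_add[symmetric]\<close>)
  then have "(\<Sum>n. emeasure (killed_law F A n) {..x})
      \<le> (\<Sum>n. ennreal (exp (\<epsilon> * x)) * (\<integral>\<^sup>+s. ennreal (exp (- \<epsilon> * s)) \<partial>killed_law F A n))"
    by (intro suminf_le) auto
  also have "\<dots> \<le> ennreal (exp (\<epsilon> * x)) * ennreal (1 / (1 - laplace \<epsilon>))"
    unfolding ennreal_suminf_cmult using assms
    by (intro mult_left_mono suminf_killed_law_laplace) auto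
  finally show ?thesis by (simp add: ennreal_mult'[symmetric])
qed

lemma ennreal_renewal: "ennreal (renewal x) = (\<Sum>n. emeasure (killed_law F {0..} n) {..x})"
proof -
  obtain \<epsilon> where "0 < \<epsilon>" "laplace \<epsilon> < 1" using laplace_lt_1[of 1] by auto
  from suminf_killed_law_atMost[OF this, of "{0..}" x] show ?thesis
    unfolding renewal_def by (intro ennreal_enn2real) (auto simp: le_less_trans)
qed

lemma renewal_nonneg: "0 \<le> renewal x"
  by (simp add: renewal_def)

lemma renewal_le_exp:
  assumes "0 < \<epsilon>" "laplace \<epsilon> < 1"
  shows "renewal x \<le> exp (\<epsilon> * x) / (1 - laplace \<epsilon>)"
  using suminf_killed_law_atMost[OF assms, of "{0..}" x] assms(2)
  by (simp add: ennreal_renewal[symmetric])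

lemma renewal_mono: "x \<le> y \<Longrightarrow> renewal x \<le> renewal y"
proof -
  assume "x \<le> y"
  then have "ennreal (renewal x) \<le> ennreal (renewal y)"
    unfolding ennreal_renewal by (intro suminf_le emeasure_mono) auto
  then show ?thesis by (simp add: renewal_nonneg)
qed

lemma borel_measurable_renewal [measurable]: "renewal \<in> borel_measurable borel"
  by (intro borel_measurable_mono monoI renewal_mono)

lemma renewal_neg: "x < 0 \<Longrightarrow> renewal x = 0"
proof -
  assume "x < 0"
  have "emeasure (killed_law F {0..} n) {..x} = 0" for n
  proof -
    have "AE s in killed_law F {0..} n. s \<notin> {..x}"
      using AE_pos by eventually_elim (use \<open>x < 0\<close> in auto)
    then show ?thesis by (subst (asm) AE_iff_measurable[of "{..x}"]) auto
  qed
  then show ?thesis by (simp add: renewal_def)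
qed

section \<open>Wiener-Hopf factorisation of the killed walks\<close>

text \<open>The next step of a walk still below zero either survives or lands in
  \<open>{0..}\<close>; the second term is the part of the ladder height law with ladder period n +
  1.\<close>

lemma nn_integral_convolution_split:
  assumes [measurable]: "f \<in> borel_measurable borel"
  shows "(\<integral>\<^sup>+t. \<integral>\<^sup>+y. f (t + y) \<partial>F \<partial>killed_law F {..<0} n) =
    (\<integral>\<^sup>+t. f t \<partial>killed_law F {..<0} (Suc n)) +
    (\<integral>\<^sup>+t. \<integral>\<^sup>+y. f (t + y) * indicator {0..} (t + y) \<partial>F \<partial>killed_law F {..<0} n)"
  by (subst nn_integral_killed_law_Suc, simp, simp, subst nn_integral_add[symmetric], simp, simp,
      rule nn_integral_cong, subst nn_integral_add[symmetric])
    (auto intro!: nn_integral_cong split: split_indicator)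

text \<open>Wiener--Hopf factorisation, graded by the number of steps so that no infinite measure is
  subtracted: a step added to the sum of two independent killed walks is charged to either walk.\<close>

lemma wiener_hopf_step:
  assumes [measurable]: "f \<in> borel_measurable borel" and neg: "\<And>z. z < 0 \<Longrightarrow> f z = 0"
  shows "(\<integral>\<^sup>+s. \<integral>\<^sup>+t. f (s + t) \<partial>killed_law F {..<0} k \<partial>killed_law F {0..} (Suc j)) =
    (\<integral>\<^sup>+s. \<integral>\<^sup>+t. f (s + t) \<partial>killed_law F {..<0} (Suc k) \<partial>killed_law F {0..} j) +
    (\<integral>\<^sup>+s. \<integral>\<^sup>+t. \<integral>\<^sup>+y. f (s + (t + y)) * indicator {0..} (t + y) \<partial>F \<partial>killed_law F {..<0} k
       \<partial>killed_law F {0..} j)"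
proof -
  interpret FK: pair_sigma_finite F "killed_law F {..<0} k" ..
  have "(\<integral>\<^sup>+s. \<integral>\<^sup>+t. f (s + t) \<partial>killed_law F {..<0} k \<partial>killed_law F {0..} (Suc j)) =
    (\<integral>\<^sup>+s. \<integral>\<^sup>+y. (\<integral>\<^sup>+t. f (s + y + t) \<partial>killed_law F {..<0} k) * indicator {0..} (s + y) \<partial>F
      \<partial>killed_law F {0..} j)"
    by (rule nn_integral_killed_law_Suc) measurable
  \<comment> \<open>Since t \<le> 0 almost surely, s + y < 0 forces s + y + t < 0, where
    \<open>f\<close> vanishes. The survival indicator can therefore be dropped, and the step y is
    handed over to the second walk.\<close>
  also have "\<dots> = (\<integral>\<^sup>+s. \<integral>\<^sup>+y. \<integral>\<^sup>+t. f (s + (t + y)) \<partial>killed_law F {..<0} k \<partial>F \<partial>killed_law F {0..} j)"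
  proof (intro nn_integral_cong)
    fix s y
    show "(\<integral>\<^sup>+t. f (s + y + t) \<partial>killed_law F {..<0} k) * indicator {0..} (s + y) =
      (\<integral>\<^sup>+t. f (s + (t + y)) \<partial>killed_law F {..<0} k)"
    proof (cases "0 \<le> s + y")
      case True
      then show ?thesis by (simp add: ac_simps)
    next
      case False
      have "(\<integral>\<^sup>+t. f (s + (t + y)) \<partial>killed_law F {..<0} k) = (\<integral>\<^sup>+t. 0 \<partial>killed_law F {..<0} k)"
        by (rule nn_integral_cong_AE, rule eventually_mono[OF AE_neg])
          (use False in \<open>auto intro!: neg\<close>)
      then show ?thesis using False by simp
    qed
  qed
  also have "\<dots> = (\<integral>\<^sup>+s. \<integral>\<^sup>+t. \<integral>\<^sup>+y. f (s + (t + y)) \<partial>F \<partial>killed_law F {..<0} k \<partial>killed_law F {0..} j)"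
    by (intro nn_integral_cong FK.Fubini'[symmetric]) measurable
  also have "\<dots> = (\<integral>\<^sup>+s. (\<integral>\<^sup>+t. f (s + t) \<partial>killed_law F {..<0} (Suc k)) +
      (\<integral>\<^sup>+t. \<integral>\<^sup>+y. f (s + (t + y)) * indicator {0..} (t + y) \<partial>F \<partial>killed_law F {..<0} k)
       \<partial>killed_law F {0..} j)"
    by (intro nn_integral_cong nn_integral_convolution_split) measurable
  also have "\<dots> = (\<integral>\<^sup>+s. \<integral>\<^sup>+t. f (s + t) \<partial>killed_law F {..<0} (Suc k) \<partial>killed_law F {0..} j) +
    (\<integral>\<^sup>+s. \<integral>\<^sup>+t. \<integral>\<^sup>+y. f (s + (t + y)) * indicator {0..} (t + y) \<partial>F \<partial>killed_law F {..<0} k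
       \<partial>killed_law F {0..} j)"
    by (intro nn_integral_add) measurable
  finally show ?thesis .
qed

text \<open>Repeating the step along j + k = n + 1 moves all steps from the first walk to the
  second: it starts at (n + 1, 0), the left-hand side, and ends at (0, n + 1), which is zero as
  \<open>f\<close> vanishes below 0. The i-th summand is i steps of the walk in \<open>{0..}\<close>
  plus an independent ladder height of period n - i + 1.\<close>

lemma wiener_hopf:
  assumes [measurable]: "f \<in> borel_measurable borel" and neg: "\<And>z. z < 0 \<Longrightarrow> f z = 0"
  shows "(\<integral>\<^sup>+s. f s \<partial>killed_law F {0..} (Suc n)) =
    (\<Sum>i<Suc n. \<integral>\<^sup>+s. \<integral>\<^sup>+t. \<integral>\<^sup>+y. f (s + (t + y)) * indicator {0..} (t + y) \<partial>F
       \<partial>killed_law F {..<0} (n - i) \<partial>killed_law F {0..} i)"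
proof -
  define b where "b = (\<lambda>j k. \<integral>\<^sup>+s. \<integral>\<^sup>+t. f (s + t) \<partial>killed_law F {..<0} k \<partial>killed_law F {0..} j)"
  define c where "c = (\<lambda>j k. \<integral>\<^sup>+s. \<integral>\<^sup>+t. \<integral>\<^sup>+y. f (s + (t + y)) * indicator {0..} (t + y) \<partial>F
       \<partial>killed_law F {..<0} k \<partial>killed_law F {0..} j)"
  have step: "b (Suc j) k = b j (Suc k) + c j k" for j k
    unfolding b_def c_def by (rule wiener_hopf_step[OF assms])
  have "b j k = b 0 (j + k) + (\<Sum>i<j. c i (j + k - Suc i))" for j k
    by (induction j arbitrary: k) (simp_all add: step add.assoc)
  from this[of "Suc n" 0] have "b (Suc n) 0 = b 0 (Suc n) + (\<Sum>i<Suc n. c i (n - i))" by simp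
  moreover have "b (Suc n) 0 = (\<integral>\<^sup>+s. f s \<partial>killed_law F {0..} (Suc n))"
    by (simp add: b_def nn_integral_return del: killed_law.simps(2))
  moreover have "b 0 (Suc n) = 0"
  proof -
    have "b 0 (Suc n) = (\<integral>\<^sup>+t. f t \<partial>killed_law F {..<0} (Suc n))"
      by (simp add: b_def nn_integral_return del: killed_law.simps(2))
    also have "\<dots> = (\<integral>\<^sup>+t. 0 \<partial>killed_law F {..<0} (Suc n))"
      by (rule nn_integral_cong_AE, rule eventually_mono[OF AE_killed_law]) (auto simp: neg)
    finally show ?thesis by simp
  qed
  ultimately show ?thesis by (simp add: c_def)
qed

section \<open>The one-step equation for the occupation function\<close>

text \<open>The mean ladder period: the n-th term is the probability that the period exceeds
  n.\<close>

definition total :: real where "total = enn2real (\<Sum>n. emeasure (killed_law F {..<0} n) UNIV)"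

lemma ennreal_total: "ennreal total = (\<Sum>n. emeasure (killed_law F {..<0} n) UNIV)"
proof -
  obtain \<epsilon> where e: "0 < \<epsilon>" "laplace \<epsilon> < 1" using laplace_lt_1[of 1] by auto
  have "emeasure (killed_law F {..<0} n) UNIV = emeasure (killed_law F {..<0} n) {..0}" for n
    by (rule emeasure_eq_AE, rule eventually_mono[OF AE_neg]) auto
  then show ?thesis
    using suminf_killed_law_atMost[OF e, of "{..<0}" 0]
    unfolding total_def by (intro ennreal_enn2real) (auto simp: le_less_trans)
qed

text \<open>The probability that the walk ever enters (-\<infinity>,0): the n-th term belongs to a
  first entry at step n + 1.\<close>

definition undershoot :: real where
  "undershoot = enn2real (\<Sum>n. \<integral>\<^sup>+s. \<integral>\<^sup>+y. indicator {..<0} (s + y) \<partial>F \<partial>killed_law F {0..} n)"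

lemma nn_integral_renewal_finite:
  "(\<integral>\<^sup>+y. ennreal (renewal (x - y)) \<partial>F) < \<infinity>"
proof -
  have "(\<integral>\<^sup>+y. ennreal (renewal (x - y)) \<partial>F) \<le> (\<integral>\<^sup>+y. ennreal (renewal (x + r)) \<partial>F)"
    by (rule nn_integral_mono_AE, rule eventually_mono[OF bounded_below])
      (auto intro!: ennreal_leI renewal_mono)
  then show ?thesis by (simp add: emeasure_space_1[simplified] le_less_trans)
qed

text \<open>A step of the surviving walk stays in \<open>{0..}\<close>, giving the next term of U,
  or falls below zero. As 0 \<le> x, every position below zero is at most x, so the second case
  contributes the same constant for all x. The \<open>1\<close> supplies the term n = 0.\<close>

lemma renewal_convolution_ennreal:
  assumes "0 \<le> x"
  shows "1 + (\<integral>\<^sup>+y. ennreal (renewal (x - y)) \<partial>F) = ennreal (renewal x) + ennreal undershoot"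
proof -
  define u where "u = (\<Sum>n. \<integral>\<^sup>+s. \<integral>\<^sup>+y. indicator {..<0} (s + y) \<partial>F \<partial>killed_law F {0..} n)"
  have em: "emeasure (killed_law F {0..} n) {..x - y} =
      (\<integral>\<^sup>+s. indicator {..x} (s + y) \<partial>killed_law F {0..} n)" for n y
  proof -
    have "(\<integral>\<^sup>+s. indicator {..x} (s + y) \<partial>killed_law F {0..} n) =
        (\<integral>\<^sup>+s. indicator {..x - y} s \<partial>killed_law F {0..} n)"
      by (intro nn_integral_cong) (auto simp: indicator_def)
    then show ?thesis by simp
  qed
  have step: "(\<integral>\<^sup>+y. emeasure (killed_law F {0..} n) {..x - y} \<partial>F) =
      emeasure (killed_law F {0..} (Suc n)) {..x} +
      (\<integral>\<^sup>+s. \<integral>\<^sup>+y. indicator {..<0} (s + y) \<partial>F \<partial>killed_law F {0..} n)" for n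
  proof -
    interpret FK: pair_sigma_finite F "killed_law F {0..} n" ..
    have "(\<integral>\<^sup>+y. emeasure (killed_law F {0..} n) {..x - y} \<partial>F) =
      (\<integral>\<^sup>+y. \<integral>\<^sup>+s. indicator {..x} (s + y) \<partial>killed_law F {0..} n \<partial>F)"
      by (simp only: em)
    also have "\<dots> = (\<integral>\<^sup>+s. \<integral>\<^sup>+y. indicator {..x} (s + y) \<partial>F \<partial>killed_law F {0..} n)"
      by (rule FK.Fubini'[symmetric]) measurable
    also have "\<dots> = (\<integral>\<^sup>+s. (\<integral>\<^sup>+y. indicator {..x} (s + y) * indicator {0..} (s + y) \<partial>F)
        + (\<integral>\<^sup>+y. indicator {..<0} (s + y) \<partial>F) \<partial>killed_law F {0..} n)"
      using assms by (intro nn_integral_cong, subst nn_integral_add[symmetric])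
        (auto intro!: nn_integral_cong simp: indicator_def)
    also have "\<dots> = (\<integral>\<^sup>+s. indicator {..x} s \<partial>killed_law F {0..} (Suc n)) +
      (\<integral>\<^sup>+s. \<integral>\<^sup>+y. indicator {..<0} (s + y) \<partial>F \<partial>killed_law F {0..} n)"
      by (subst nn_integral_add)
        (simp_all add: nn_integral_killed_law_Suc del: killed_law.simps(2) nn_integral_indicator)
    finally show ?thesis by simp
  qed
  have "(\<integral>\<^sup>+y. ennreal (renewal (x - y)) \<partial>F) = (\<Sum>n. \<integral>\<^sup>+y. emeasure (killed_law F {0..} n) {..x - y} \<partial>F)"
    unfolding ennreal_renewal em by (rule nn_integral_suminf) measurable
  also have "\<dots> = (\<Sum>n. emeasure (killed_law F {0..} (Suc n)) {..x}) + u"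
    by (simp only: step u_def) (rule suminf_add[symmetric]; simp)
  finally have eq: "(\<integral>\<^sup>+y. ennreal (renewal (x - y)) \<partial>F) =
      (\<Sum>n. emeasure (killed_law F {0..} (Suc n)) {..x}) + u" .
  then have "u \<le> (\<integral>\<^sup>+y. ennreal (renewal (x - y)) \<partial>F)" by simp
  then have "u = ennreal undershoot"
    unfolding undershoot_def u_def[symmetric]
    using nn_integral_renewal_finite[of x] by (intro ennreal_enn2real[symmetric]) (auto simp: le_less_trans)
  moreover have "ennreal (renewal x) = (\<Sum>n. emeasure (killed_law F {0..} (Suc n)) {..x}) + 1"
    unfolding ennreal_renewal using assms
    by (subst ennreal_suminf_head) (simp add: indicator_def del: killed_law.simps(2))
  ultimately show ?thesis by (simp add: eq ac_simps)
qed

lemma undershoot_nonneg: "0 \<le> undershoot"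
  by (simp add: undershoot_def)

section \<open>The integral of the occupation function\<close>

definition integrated_renewal :: "real \<Rightarrow> real" where
  "integrated_renewal x = (LINT y:{0..x}|lborel. renewal y)"

text \<open>U vanishes below 0, so the lower limit can be moved to -\<infinity>; in this form
  shifting the argument of W is a mere substitution.\<close>

lemma ennreal_integrated_renewal:
  "ennreal (integrated_renewal x) = (\<integral>\<^sup>+s. ennreal (renewal s) * indicator {..x} s \<partial>lborel)"
proof -
  have eq: "ennreal (renewal s) * indicator {..x} s = ennreal (indicator {0..x} s *\<^sub>R renewal s)" for s
    by (auto simp: indicator_def renewal_neg)
  have "(\<integral>\<^sup>+s. ennreal (indicator {0..x} s *\<^sub>R renewal s) \<partial>lborel) < \<infinity>"
  proof -
    have "(\<integral>\<^sup>+s. ennreal (indicator {0..x} s *\<^sub>R renewal s) \<partial>lborel)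
        \<le> (\<integral>\<^sup>+s. ennreal (renewal x) * indicator {0..x} s \<partial>lborel)"
      by (intro nn_integral_mono) (auto simp: indicator_def intro!: ennreal_leI renewal_mono)
    also have "\<dots> < \<infinity>" by (auto simp: nn_integral_cmult ennreal_mult_less_top emeasure_lborel_Icc_eq)
    finally show ?thesis .
  qed
  then show ?thesis
    unfolding eq integrated_renewal_def set_lebesgue_integral_def
    by (intro nn_integral_eq_integral[symmetric] integrableI_nonneg)
      (auto simp: renewal_nonneg)
qed

lemma integrated_renewal_nonneg: "0 \<le> integrated_renewal x"
  unfolding integrated_renewal_def set_lebesgue_integral_def
  by (intro integral_nonneg_AE) (simp add: renewal_nonneg)

lemma integrated_renewal_mono: "x \<le> y \<Longrightarrow> integrated_renewal x \<le> integrated_renewal y"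
proof -
  assume "x \<le> y"
  then have "ennreal (integrated_renewal x) \<le> ennreal (integrated_renewal y)"
    unfolding ennreal_integrated_renewal by (intro nn_integral_mono) (auto simp: indicator_def)
  then show ?thesis by (simp add: integrated_renewal_nonneg)
qed

lemma borel_measurable_integrated_renewal [measurable]: "integrated_renewal \<in> borel_measurable borel"
  by (intro borel_measurable_mono monoI integrated_renewal_mono)

lemma integrated_renewal_nonpos: "x \<le> 0 \<Longrightarrow> integrated_renewal x = 0"
proof -
  assume "x \<le> 0"
  then have "integrated_renewal x \<le> integrated_renewal 0" by (rule integrated_renewal_mono)
  also have "integrated_renewal 0 = 0"
    unfolding integrated_renewal_def set_lebesgue_integral_def
    by (rule integral_eq_zero_AE, rule AE_I[where N = "{0}"]) (auto simp: indicator_def)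
  finally show ?thesis using integrated_renewal_nonneg[of x] by simp
qed

lemma integrated_renewal_le_exp:
  assumes "0 < \<epsilon>" "laplace \<epsilon> < 1" "0 \<le> x"
  shows "integrated_renewal x \<le> exp (\<epsilon> * x) / (\<epsilon> * (1 - laplace \<epsilon>))"
proof -
  define c where "c = 1 / (1 - laplace \<epsilon>)"
  have c: "0 \<le> c" using assms by (simp add: c_def)
  have "ennreal (integrated_renewal x) \<le> (\<integral>\<^sup>+s. ennreal (c * exp (\<epsilon> * s)) * indicator {0..x} s \<partial>lborel)"
    unfolding ennreal_integrated_renewal
  proof (rule nn_integral_mono)
    fix s
    show "ennreal (renewal s) * indicator {..x} s \<le> ennreal (c * exp (\<epsilon> * s)) * indicator {0..x} s"
      using renewal_le_exp[OF assms(1,2), of s]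
      by (cases "s < 0") (auto simp: indicator_def renewal_neg c_def intro!: ennreal_leI)
  qed
  also have "\<dots> = ennreal (c * exp (\<epsilon> * x) / \<epsilon> - c * exp (\<epsilon> * 0) / \<epsilon>)"
    using assms(1,3) c by (intro nn_integral_FTC_Icc) (auto intro!: derivative_eq_intros)
  also have "\<dots> \<le> ennreal (c * exp (\<epsilon> * x) / \<epsilon>)"
    using assms(1) c by (intro ennreal_leI) simp
  finally have "integrated_renewal x \<le> c * exp (\<epsilon> * x) / \<epsilon>"
    using assms(1) c by simp
  then show ?thesis by (simp add: c_def mult.commute)
qed

lemma integrable_integrated_renewal: "integrable F (\<lambda>y. integrated_renewal (x - y))"
proof (rule integrable_const_bound[where B = "integrated_renewal (x + r)"])
  show "AE y in F. norm (integrated_renewal (x - y)) \<le> integrated_renewal (x + r)"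
    using bounded_below
    by eventually_elim (auto simp: integrated_renewal_nonneg intro!: integrated_renewal_mono)
qed simp

lemma nn_integral_integrated_renewal:
  "(\<integral>\<^sup>+y. ennreal (integrated_renewal (x - y)) \<partial>F) = ennreal (\<integral>y. integrated_renewal (x - y) \<partial>F)"
  by (intro nn_integral_eq_integral integrable_integrated_renewal) (simp add: integrated_renewal_nonneg)

lemma integrated_renewal_convolution:
  assumes "0 \<le> x"
  shows "(\<integral>y. integrated_renewal (x - y) \<partial>F) =
    integrated_renewal x + (\<integral>y. integrated_renewal (- y) \<partial>F) - (1 - undershoot) * x"
proof -
  interpret P: pair_sigma_finite F lborel ..
  define PU where "PU s = (\<integral>\<^sup>+y. ennreal (renewal (s - y)) \<partial>F)" for s
  have [measurable]: "PU \<in> borel_measurable borel" unfolding PU_def by measurable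
  have K: "(\<integral>\<^sup>+y. ennreal (integrated_renewal (z - y)) \<partial>F) = (\<integral>\<^sup>+s. PU s * indicator {..z} s \<partial>lborel)" for z
  proof -
    have "ennreal (integrated_renewal (z - y)) =
        (\<integral>\<^sup>+s. ennreal (renewal (s - y)) * indicator {..z} s \<partial>lborel)" for y
      unfolding ennreal_integrated_renewal
      by (subst nn_integral_real_affine[where c = 1 and t = "- y"])
        (auto simp: indicator_def intro!: nn_integral_cong)
    then have "(\<integral>\<^sup>+y. ennreal (integrated_renewal (z - y)) \<partial>F) =
      (\<integral>\<^sup>+y. \<integral>\<^sup>+s. ennreal (renewal (s - y)) * indicator {..z} s \<partial>lborel \<partial>F)" by simp
    also have "\<dots> = (\<integral>\<^sup>+s. \<integral>\<^sup>+y. ennreal (renewal (s - y)) * indicator {..z} s \<partial>F \<partial>lborel)"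
      by (rule P.Fubini'[symmetric]) measurable
    also have "\<dots> = (\<integral>\<^sup>+s. PU s * indicator {..z} s \<partial>lborel)"
      unfolding PU_def by (intro nn_integral_cong nn_integral_multc) measurable
    finally show ?thesis .
  qed
  have "(\<integral>\<^sup>+s. PU s * indicator {..x} s \<partial>lborel) =
    (\<integral>\<^sup>+s. PU s * indicator {..0} s + PU s * indicator {0<..x} s \<partial>lborel)"
    using assms by (intro nn_integral_cong) (auto simp: indicator_def)
  also have "\<dots> = (\<integral>\<^sup>+s. PU s * indicator {..0} s \<partial>lborel) + (\<integral>\<^sup>+s. PU s * indicator {0<..x} s \<partial>lborel)"
    by (rule nn_integral_add) measurable
  finally have split: "(\<integral>\<^sup>+s. PU s * indicator {..x} s \<partial>lborel) =
    (\<integral>\<^sup>+s. PU s * indicator {..0} s \<partial>lborel) + (\<integral>\<^sup>+s. PU s * indicator {0<..x} s \<partial>lborel)" .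
  have "(\<integral>\<^sup>+s. PU s * indicator {0<..x} s \<partial>lborel) + ennreal x =
      (\<integral>\<^sup>+s. PU s * indicator {0<..x} s + indicator {0<..x} s \<partial>lborel)"
    using assms by (subst nn_integral_add) auto
  also have "\<dots> = (\<integral>\<^sup>+s. ennreal (renewal s) * indicator {0<..x} s + ennreal undershoot * indicator {0<..x} s \<partial>lborel)"
  proof (intro nn_integral_cong)
    fix s
    show "PU s * indicator {0<..x} s + indicator {0<..x} s =
      ennreal (renewal s) * indicator {0<..x} s + ennreal undershoot * indicator {0<..x} s"
      using renewal_convolution_ennreal[of s] by (auto simp: indicator_def PU_def add.commute)
  qed
  also have "\<dots> = (\<integral>\<^sup>+s. ennreal (renewal s) * indicator {0<..x} s \<partial>lborel) + ennreal (undershoot * x)"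
    using assms undershoot_nonneg by (subst nn_integral_add) (auto simp: nn_integral_cmult ennreal_mult)
  also have "(\<integral>\<^sup>+s. ennreal (renewal s) * indicator {0<..x} s \<partial>lborel) = ennreal (integrated_renewal x)"
    unfolding ennreal_integrated_renewal
  proof (rule nn_integral_cong_AE, rule eventually_mono[OF AE_lborel_singleton[of 0]])
    fix s :: real assume "s \<noteq> 0"
    then show "ennreal (renewal s) * indicator {0<..x} s = ennreal (renewal s) * indicator {..x} s"
      by (cases "s < 0") (auto simp: indicator_def renewal_neg)
  qed
  finally have "ennreal (\<integral>y. integrated_renewal (x - y) \<partial>F) + ennreal x =
    ennreal (\<integral>y. integrated_renewal (0 - y) \<partial>F) + (ennreal (integrated_renewal x) + ennreal (undershoot * x))"
    unfolding nn_integral_integrated_renewal[symmetric] K split by (simp add: add.assoc)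
  moreover have nonneg: "0 \<le> (\<integral>y. integrated_renewal (z - y) \<partial>F)" for z
    by (intro integral_nonneg_AE) (simp add: integrated_renewal_nonneg)
  ultimately have "(\<integral>y. integrated_renewal (x - y) \<partial>F) + x =
      (\<integral>y. integrated_renewal (0 - y) \<partial>F) + (integrated_renewal x + undershoot * x)"
    using assms undershoot_nonneg integrated_renewal_nonneg[of x] nonneg[of x] nonneg[of 0]
    by (simp add: ennreal_plus[symmetric] del: ennreal_plus)
  then show ?thesis by (simp add: algebra_simps)
qed

section \<open>Uniqueness under exponential growth\<close>

text \<open>For y in [-r,x] the argument x - y is nonnegative, so the bound on \<open>w\<close> can
  be reinserted into the equation; each round multiplies it by
  \<open>laplace \<epsilon>\<close>.\<close>

lemma homogeneous_solution_zero:
  assumes int: "\<And>x. 0 \<le> x \<Longrightarrow> set_integrable F {- r..x} (\<lambda>y. w (x - y))"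
    and eq: "\<And>x. 0 \<le> x \<Longrightarrow> w x = (LINT y:{- r..x}|F. w (x - y))"
    and bd: "\<And>x. 0 \<le> x \<Longrightarrow> \<bar>w x\<bar> \<le> K * exp (\<epsilon> * x)"
    and e: "0 < \<epsilon>" "laplace \<epsilon> < 1" and "0 \<le> x"
  shows "w x = 0"
proof -
  have K: "0 \<le> K" using bd[of 0] by simp
  have le: "\<bar>w x\<bar> \<le> K * laplace \<epsilon> ^ n * exp (\<epsilon> * x)" if "0 \<le> x" for n x
    using that
  proof (induction n arbitrary: x)
    case 0
    then show ?case using bd by simp
  next
    case (Suc n)
    have "\<bar>w x\<bar> \<le> (\<integral>y. norm (indicator {- r..x} y *\<^sub>R w (x - y)) \<partial>F)"
      unfolding eq[OF Suc.prems] set_lebesgue_integral_def real_norm_def[symmetric]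
      by (rule integral_norm_bound)
    also have "\<dots> \<le> (\<integral>y. K * laplace \<epsilon> ^ n * exp (\<epsilon> * x) * exp (- \<epsilon> * y) \<partial>F)"
    proof (rule integral_mono)
      show "integrable F (\<lambda>y. norm (indicator {- r..x} y *\<^sub>R w (x - y)))"
        using int[OF Suc.prems] unfolding set_integrable_def by (rule integrable_norm)
      show "integrable F (\<lambda>y. K * laplace \<epsilon> ^ n * exp (\<epsilon> * x) * exp (- \<epsilon> * y))"
        using e by (intro integrable_mult_right integrable_exp) simp
      fix y
      show "norm (indicator {- r..x} y *\<^sub>R w (x - y)) \<le> K * laplace \<epsilon> ^ n * exp (\<epsilon> * x) * exp (- \<epsilon> * y)"
        using Suc.IH[of "x - y"] K laplace_nonneg
        by (auto simp: indicator_def algebra_simps exp_diff exp_minus divide_inverse)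
    qed
    also have "\<dots> = K * laplace \<epsilon> ^ Suc n * exp (\<epsilon> * x)"
      by (simp add: laplace_def)
    finally show ?case .
  qed
  have "(\<lambda>n. K * laplace \<epsilon> ^ n * exp (\<epsilon> * x)) \<longlonglongrightarrow> K * 0 * exp (\<epsilon> * x)"
    using e laplace_nonneg[of \<epsilon>] by (intro tendsto_intros LIMSEQ_realpow_zero) auto
  then have "\<bar>w x\<bar> \<le> K * 0 * exp (\<epsilon> * x)"
    by (rule LIMSEQ_le_const) (use le[OF \<open>0 \<le> x\<close>] in blast)
  then show ?thesis by simp
qed

section \<open>The inventory recursion\<close>

lemma prob_space_lindley: "prob_space (lindley F t)"
proof (induction t)
  case 0
  show ?case by (simp add: prob_space_return)
next
  case (Suc t)
  interpret L: prob_space "lindley F t" by (rule Suc)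
  interpret P: pair_prob_space "lindley F t" F ..
  show ?case unfolding lindley.simps by (rule P.prob_space_distr) measurable
qed

end

sublocale net_demand \<subseteq> lindley: prob_space "lindley F t" for t
  by (rule prob_space_lindley)

context net_demand
begin

lemma real_distribution_lindley: "real_distribution (lindley F t)"
  by unfold_locales auto

lemma nn_integral_lindley_Suc:
  assumes [measurable]: "f \<in> borel_measurable borel"
  shows "(\<integral>\<^sup>+s. f s \<partial>lindley F (Suc t)) = (\<integral>\<^sup>+s. \<integral>\<^sup>+y. f (max (s - y) 0) \<partial>F \<partial>lindley F t)"
  by (simp add: nn_integral_distr split_beta' nn_integral_fst[symmetric])

lemma AE_lindley: "AE s in lindley F t. 0 \<le> s"
proof (cases t)
  case 0
  show ?thesis unfolding 0 lindley.simps by (subst AE_return) simp_all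
next
  case (Suc n)
  show ?thesis unfolding Suc lindley.simps by (subst AE_distr_iff) (auto simp: split_beta')
qed

text \<open>From 0, the smallest state, the first step can only go up, and the map s \<mapsto> max
  (s - y) 0 is increasing, so later steps preserve the order.\<close>

lemma lindley_stochastically_mono:
  assumes "f \<in> borel_measurable borel" "mono f"
  shows "(\<integral>\<^sup>+s. f s \<partial>lindley F t) \<le> (\<integral>\<^sup>+s. f s \<partial>lindley F (Suc t))"
  using assms
proof (induction t arbitrary: f)
  case 0
  note [measurable] = 0(1)
  have "(\<integral>\<^sup>+s. f s \<partial>lindley F 0) = (\<integral>\<^sup>+s. \<integral>\<^sup>+y. f 0 \<partial>F \<partial>lindley F 0)"
    using emeasure_space_1 lindley.emeasure_space_1[of 0] by (simp add: nn_integral_return)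
  also have "\<dots> \<le> (\<integral>\<^sup>+s. f s \<partial>lindley F (Suc 0))"
    unfolding nn_integral_lindley_Suc[OF 0(1)]
    by (intro nn_integral_mono monoD[OF 0(2)]) simp
  finally show ?case .
next
  case (Suc t)
  note [measurable] = Suc.prems(1)
  show ?case
    unfolding nn_integral_lindley_Suc[OF Suc.prems(1)]
  proof (rule Suc.IH)
    show "mono (\<lambda>s. \<integral>\<^sup>+y. f (max (s - y) 0) \<partial>F)"
      by (intro monoI nn_integral_mono monoD[OF Suc.prems(2)]) auto
  qed measurable
qed

text \<open>Since exp(\<epsilon> max (s - y) 0) \<le> 1 + exp(\<epsilon> s) exp(-\<epsilon> y), one
  step takes a bound a to 1 + a * \<open>laplace \<epsilon>\<close>. The stated bound is the fixed
  point of this map and hence persists for all t.\<close>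

lemma lindley_laplace:
  assumes "0 < \<epsilon>" "laplace \<epsilon> < 1"
  shows "(\<integral>\<^sup>+s. ennreal (exp (\<epsilon> * s)) \<partial>lindley F t) \<le> ennreal (1 / (1 - laplace \<epsilon>))"
proof (induction t)
  case 0
  then show ?case using assms laplace_nonneg[of \<epsilon>] by (simp add: nn_integral_return field_simps)
next
  case (Suc t)
  have "(\<integral>\<^sup>+s. ennreal (exp (\<epsilon> * s)) \<partial>lindley F (Suc t)) \<le>
    (\<integral>\<^sup>+s. \<integral>\<^sup>+y. 1 + ennreal (exp (\<epsilon> * s)) * ennreal (exp (- \<epsilon> * y)) \<partial>F \<partial>lindley F t)"
    by (subst nn_integral_lindley_Suc, simp, intro nn_integral_mono)
      (auto simp: max_def ennreal_mult'[symmetric] exp_add[symmetric] algebra_simps)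
  also have "\<dots> = 1 + (\<integral>\<^sup>+s. ennreal (exp (\<epsilon> * s)) \<partial>lindley F t) * ennreal (laplace \<epsilon>)"
    using nn_integral_exp[of \<epsilon>] assms emeasure_space_1 lindley.emeasure_space_1[of t]
    by (simp add: nn_integral_add nn_integral_cmult nn_integral_multc)
  also have "\<dots> \<le> 1 + ennreal (1 / (1 - laplace \<epsilon>)) * ennreal (laplace \<epsilon>)"
    by (intro add_left_mono mult_right_mono Suc) simp
  also have "\<dots> = ennreal (1 + 1 / (1 - laplace \<epsilon>) * laplace \<epsilon>)"
    using assms laplace_nonneg[of \<epsilon>] by (simp add: ennreal_mult'[symmetric])
  also have "1 + 1 / (1 - laplace \<epsilon>) * laplace \<epsilon> = 1 / (1 - laplace \<epsilon>)"
    using assms by (simp add: field_simps)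
  finally show ?case .
qed

text \<open>The integrals increase by stochastic monotonicity and are bounded by the common
  exponential moment.\<close>

lemma nn_integral_lindley_convergent:
  assumes [measurable]: "f \<in> borel_measurable borel" and "mono f" "\<And>s. 0 \<le> f s"
    and bd: "\<And>s. 0 \<le> s \<Longrightarrow> f s \<le> K * exp (\<epsilon> * s)" and e: "0 < \<epsilon>" "laplace \<epsilon> < 1"
  obtains l where "0 \<le> l" "(\<lambda>t. \<integral>\<^sup>+s. ennreal (f s) \<partial>lindley F t) \<longlonglongrightarrow> ennreal l"
proof -
  define j where "j t = (\<integral>\<^sup>+s. ennreal (f s) \<partial>lindley F t)" for t
  have K: "0 \<le> K" using bd[of 0] assms(3)[of 0] by simp
  have j: "j t \<le> ennreal (K / (1 - laplace \<epsilon>))" for t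
  proof -
    have "j t \<le> (\<integral>\<^sup>+s. ennreal K * ennreal (exp (\<epsilon> * s)) \<partial>lindley F t)"
      unfolding j_def
      by (rule nn_integral_mono_AE, rule eventually_mono[OF AE_lindley])
        (use bd K in \<open>auto simp: ennreal_mult'[symmetric] intro!: ennreal_leI\<close>)
    also have "\<dots> \<le> ennreal K * ennreal (1 / (1 - laplace \<epsilon>))"
      by (subst nn_integral_cmult) (auto intro!: mult_left_mono lindley_laplace e)
    also have "\<dots> = ennreal (K / (1 - laplace \<epsilon>))"
      using K e by (simp add: ennreal_mult'[symmetric])
    finally show ?thesis .
  qed
  define l where "l = (SUP t. j t)"
  have "j \<longlonglongrightarrow> l"
    unfolding l_def
  proof (rule LIMSEQ_SUP, rule incseq_SucI)
    fix t show "j t \<le> j (Suc t)" unfolding j_def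
      using assms(2) by (intro lindley_stochastically_mono) (auto simp: mono_def intro!: ennreal_leI)
  qed
  moreover have "l \<le> ennreal (K / (1 - laplace \<epsilon>))"
    unfolding l_def by (intro SUP_least j)
  then have "l = ennreal (enn2real l)" by (simp add: ennreal_enn2real le_less_trans)
  ultimately have "j \<longlonglongrightarrow> ennreal (enn2real l)" by simp
  then show ?thesis using that[of "enn2real l"] by (simp add: j_def[abs_def])
qed

text \<open>Exponential moments keep the mean of \<open>W(J\<^sub>t)\<close> bounded, and it increases with \<open>t\<close>; its
  increments, which are affine in the mean of \<open>J\<^sub>t\<close>, therefore tend to \<open>0\<close>.\<close>

lemma lindley_mean_limit:
  obtains l where "0 \<le> l" "(\<lambda>t. \<integral>\<^sup>+s. ennreal s \<partial>lindley F t) \<longlonglongrightarrow> ennreal l"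
    "(\<integral>y. integrated_renewal (- y) \<partial>F) = (1 - undershoot) * l"
proof -
  obtain \<epsilon> where e: "0 < \<epsilon>" "laplace \<epsilon> < 1" using laplace_lt_1[of 1] by auto
  define C where "C = (\<integral>y. integrated_renewal (- y) \<partial>F)"
  have C: "0 \<le> C" unfolding C_def by (intro integral_nonneg_AE) (simp add: integrated_renewal_nonneg)
  define j where "j t = (\<integral>\<^sup>+s. ennreal s \<partial>lindley F t)" for t
  define w where "w t = (\<integral>\<^sup>+s. ennreal (integrated_renewal s) \<partial>lindley F t)" for t
  \<comment> \<open>\<open>ennreal\<close> already truncates negative s; \<open>max 0\<close> makes
    the integrand nonnegative and monotone, as the convergence lemma demands.\<close>
  have "(\<integral>\<^sup>+s. ennreal (max 0 s) \<partial>lindley F t) = j t" for t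
    unfolding j_def by (intro nn_integral_cong) (auto simp: max_def ennreal_neg)
  moreover obtain l where "0 \<le> l" "(\<lambda>t. \<integral>\<^sup>+s. ennreal (max 0 s) \<partial>lindley F t) \<longlonglongrightarrow> ennreal l"
  proof (rule nn_integral_lindley_convergent[of "max 0" "1 / \<epsilon>" \<epsilon>])
    fix s :: real assume "0 \<le> s"
    moreover have "\<epsilon> * s \<le> exp (\<epsilon> * s)" using exp_ge_add_one_self[of "\<epsilon> * s"] by linarith
    ultimately show "max 0 s \<le> 1 / \<epsilon> * exp (\<epsilon> * s)" using e by (simp add: field_simps)
  qed (use e in \<open>auto simp: mono_def\<close>)
  ultimately have l: "0 \<le> l" "j \<longlonglongrightarrow> ennreal l" by (simp_all add: j_def[abs_def])
  obtain m where m: "0 \<le> m" "w \<longlonglongrightarrow> ennreal m"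
    unfolding w_def[abs_def]
    by (rule nn_integral_lindley_convergent[of integrated_renewal "1 / (\<epsilon> * (1 - laplace \<epsilon>))" \<epsilon>])
      (use e integrated_renewal_le_exp[OF e] in
        \<open>auto simp: mono_def integrated_renewal_nonneg intro!: integrated_renewal_mono\<close>)
  \<comment> \<open>The increment of the mean of W(J_t), written without subtraction. As W vanishes
    on (-\<infinity>,0], the reflection at 0 does not change W(s - y).\<close>
  have step: "w (Suc t) + j t = ennreal C + w t + ennreal undershoot * j t" for t
  proof -
    have "w (Suc t) + j t =
      (\<integral>\<^sup>+s. (\<integral>\<^sup>+y. ennreal (integrated_renewal (max (s - y) 0)) \<partial>F) + ennreal s \<partial>lindley F t)"
      unfolding w_def j_def by (subst nn_integral_lindley_Suc, simp, subst nn_integral_add) auto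
    also have "\<dots> = (\<integral>\<^sup>+s. ennreal C + ennreal (integrated_renewal s) + ennreal undershoot * ennreal s \<partial>lindley F t)"
    proof (rule nn_integral_cong_AE, rule eventually_mono[OF AE_lindley])
      fix s :: real assume s: "0 \<le> s"
      have "integrated_renewal (max (s - y) 0) = integrated_renewal (s - y)" for y
        by (simp add: max_def integrated_renewal_nonpos)
      then have "(\<integral>\<^sup>+y. ennreal (integrated_renewal (max (s - y) 0)) \<partial>F) =
          ennreal (\<integral>y. integrated_renewal (s - y) \<partial>F)"
        by (simp add: nn_integral_integrated_renewal)
      moreover have "0 \<le> (\<integral>y. integrated_renewal (s - y) \<partial>F)"
        by (intro integral_nonneg_AE) (simp add: integrated_renewal_nonneg)
      moreover have "(\<integral>y. integrated_renewal (s - y) \<partial>F) + s = C + integrated_renewal s + undershoot * s"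
        using integrated_renewal_convolution[OF s] by (simp add: C_def algebra_simps)
      ultimately show "(\<integral>\<^sup>+y. ennreal (integrated_renewal (max (s - y) 0)) \<partial>F) + ennreal s =
          ennreal C + ennreal (integrated_renewal s) + ennreal undershoot * ennreal s"
        using s C undershoot_nonneg integrated_renewal_nonneg[of s]
        by (simp add: ennreal_plus[symmetric] ennreal_mult[symmetric] del: ennreal_plus)
    qed
    also have "\<dots> = ennreal C + w t + ennreal undershoot * j t"
      using lindley.emeasure_space_1[of t] unfolding w_def j_def
      by (simp add: nn_integral_add nn_integral_cmult)
    finally show ?thesis .
  qed
  have "(\<lambda>t. w (Suc t) + j t) \<longlonglongrightarrow> ennreal m + ennreal l"
    by (intro tendsto_add LIMSEQ_Suc m l)
  moreover have "(\<lambda>t. ennreal C + w t + ennreal undershoot * j t) \<longlonglongrightarrow>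
      ennreal C + ennreal m + ennreal undershoot * ennreal l"
    by (intro tendsto_add tendsto_const ennreal_tendsto_cmult m l) auto
  ultimately have "ennreal m + ennreal l = ennreal C + ennreal m + ennreal undershoot * ennreal l"
    unfolding step by (rule LIMSEQ_unique)
  \<comment> \<open>The finite limit \<open>m\<close> cancels, and what is left determines
    \<open>C\<close>.\<close>
  then have "m + l = C + m + undershoot * l"
    using m(1) l(1) C undershoot_nonneg
    by (simp add: ennreal_plus[symmetric] ennreal_mult[symmetric] del: ennreal_plus)
  then have "C = (1 - undershoot) * l" by (simp add: algebra_simps)
  then show ?thesis using that l by (simp add: C_def j_def[abs_def])
qed

section \<open>The steady-state distribution and its mean\<close>

definition stationary_cdf :: "real \<Rightarrow> real" where
  "stationary_cdf x = lim (\<lambda>t. cdf (lindley F t) x)"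

lemma cdf_lindley_decreasing: "decseq (\<lambda>t. cdf (lindley F t) x)"
proof (rule decseq_SucI)
  fix t
  have "mono (indicator {x<..} :: real \<Rightarrow> ennreal)" by (auto simp: mono_def indicator_def)
  then have "emeasure (lindley F t) {x<..} \<le> emeasure (lindley F (Suc t)) {x<..}"
    using lindley_stochastically_mono[of "indicator {x<..}" t] by (simp del: lindley.simps)
  then have "measure (lindley F t) {x<..} \<le> measure (lindley F (Suc t)) {x<..}"
    by (simp add: lindley.emeasure_eq_measure del: lindley.simps)
  moreover have "measure (lindley F t) {x<..} = 1 - cdf (lindley F t) x" for t
    using lindley.prob_compl[of "{..x}" t] by (simp add: cdf_def Compl_eq_Diff_UNIV[symmetric] del: lindley.simps)
  ultimately show "cdf (lindley F (Suc t)) x \<le> cdf (lindley F t) x" by (simp del: lindley.simps)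
qed

lemma cdf_lindley_tendsto: "(\<lambda>t. cdf (lindley F t) x) \<longlonglongrightarrow> stationary_cdf x"
proof -
  have "convergent (\<lambda>t. cdf (lindley F t) x)"
    by (rule decseq_convergent[OF cdf_lindley_decreasing, of 0]) (auto simp: cdf_def convergent_def)
  then show ?thesis unfolding stationary_cdf_def by (rule convergent_LIMSEQ_iff[THEN iffD1])
qed

lemma stationary_cdf_mono: "x \<le> y \<Longrightarrow> stationary_cdf x \<le> stationary_cdf y"
  by (intro LIMSEQ_le[OF cdf_lindley_tendsto cdf_lindley_tendsto])
    (auto intro!: lindley.finite_measure_mono simp: cdf_def)

lemma stationary_cdf_le: "stationary_cdf x \<le> cdf (lindley F t) x"
  by (rule decseq_ge[OF cdf_lindley_decreasing cdf_lindley_tendsto])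

lemma stationary_cdf_neg: "x < 0 \<Longrightarrow> stationary_cdf x = 0"
proof -
  assume "x < 0"
  have "stationary_cdf x \<le> cdf (lindley F 0) x" by (rule stationary_cdf_le)
  also have "\<dots> = 0" using \<open>x < 0\<close> by (simp add: cdf_def measure_return)
  finally have "stationary_cdf x \<le> 0" .
  moreover have "0 \<le> stationary_cdf x"
    by (rule LIMSEQ_le_const[OF cdf_lindley_tendsto]) (simp add: cdf_def)
  ultimately show ?thesis by simp
qed

text \<open>A decreasing limit of right-continuous nondecreasing functions: the limit lies below an
  approximant that is already close to it at \<open>a\<close>.\<close>

lemma stationary_cdf_right_cont: "continuous (at_right a) stationary_cdf"
proof (subst continuous_at_right_real_increasing, rule stationary_cdf_mono, assumption, intro allI impI)
  fix \<delta> :: real assume "0 < \<delta>"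
  have "\<forall>\<^sub>F t in sequentially. cdf (lindley F t) a < stationary_cdf a + \<delta> / 2"
    using \<open>0 < \<delta>\<close> by (intro order_tendstoD(2)[OF cdf_lindley_tendsto]) simp
  then obtain t where t: "cdf (lindley F t) a < stationary_cdf a + \<delta> / 2"
    by (auto simp: eventually_sequentially)
  interpret L: real_distribution "lindley F t" by (rule real_distribution_lindley)
  have "continuous (at_right a) (cdf (lindley F t))" by (rule L.cdf_is_right_cont)
  then obtain d where "0 < d" "cdf (lindley F t) (a + d) - cdf (lindley F t) a < \<delta> / 2"
    using \<open>0 < \<delta>\<close> continuous_at_right_real_increasing[of "cdf (lindley F t)" a] L.cdf_nondecreasing
    by (meson half_gt_zero)
  then show "\<exists>d>0. stationary_cdf (a + d) - stationary_cdf a < \<delta>"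
    using t stationary_cdf_le[of "a + d" t] by (intro exI[of _ d]) auto
qed

lemma stationary_cdf_at_bot: "(stationary_cdf \<longlongrightarrow> 0) at_bot"
  by (rule tendsto_eventually, rule eventually_at_bot_linorderI[of "-1"]) (simp add: stationary_cdf_neg)

text \<open>Tightness: the exponential moment common to all t bounds the tails by c exp(-\<epsilon>
  x), so no mass escapes to infinity in the limit.\<close>

lemma stationary_cdf_at_top: "(stationary_cdf \<longlongrightarrow> 1) at_top"
proof -
  obtain \<epsilon> where e: "0 < \<epsilon>" "laplace \<epsilon> < 1" using laplace_lt_1[of 1] by auto
  define c where "c = 1 / (1 - laplace \<epsilon>)"
  have c: "0 \<le> c" using e by (simp add: c_def)
  have lower: "1 - c * exp (- \<epsilon> * x) \<le> cdf (lindley F t) x" for t x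
  proof -
    have "emeasure (lindley F t) {x<..} = (\<integral>\<^sup>+s. indicator {x<..} s \<partial>lindley F t)" by simp
    also have "\<dots> \<le> (\<integral>\<^sup>+s. ennreal (exp (- \<epsilon> * x)) * ennreal (exp (\<epsilon> * s)) \<partial>lindley F t)"
      using e by (intro nn_integral_mono)
        (auto simp: indicator_def ennreal_mult'[symmetric] exp_add[symmetric])
    also have "\<dots> \<le> ennreal (exp (- \<epsilon> * x)) * ennreal c"
      unfolding c_def by (subst nn_integral_cmult) (auto intro!: mult_left_mono lindley_laplace e)
    also have "\<dots> = ennreal (c * exp (- \<epsilon> * x))" by (simp add: ennreal_mult'[symmetric] mult.commute c)
    finally have "measure (lindley F t) {x<..} \<le> c * exp (- \<epsilon> * x)"
      using c by (simp add: lindley.emeasure_eq_measure)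
    moreover have "measure (lindley F t) {x<..} = 1 - cdf (lindley F t) x"
      using lindley.prob_compl[of "{..x}" t] by (simp add: cdf_def Compl_eq_Diff_UNIV[symmetric])
    ultimately show ?thesis by simp
  qed
  show ?thesis
  proof (rule tendsto_sandwich)
    show "\<forall>\<^sub>F x in at_top. 1 - c * exp (- \<epsilon> * x) \<le> stationary_cdf x"
      using lower by (intro always_eventually allI LIMSEQ_le_const[OF cdf_lindley_tendsto]) auto
    show "\<forall>\<^sub>F x in at_top. stationary_cdf x \<le> 1"
      by (intro always_eventually allI order_trans[OF stationary_cdf_le[of _ 0]])
        (simp add: cdf_def measure_return indicator_def)
    show "((\<lambda>x. 1 - c * exp (- \<epsilon> * x)) \<longlongrightarrow> 1) at_top"
      using e(1) by real_asymp
  qed auto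
qed

lemma real_distribution_stationary: "real_distribution (interval_measure stationary_cdf)"
  by (intro real_distribution_interval_measure stationary_cdf_mono stationary_cdf_right_cont
      stationary_cdf_at_bot stationary_cdf_at_top)

lemma cdf_stationary: "cdf (interval_measure stationary_cdf) = stationary_cdf"
  by (intro cdf_interval_measure stationary_cdf_mono stationary_cdf_right_cont stationary_cdf_at_bot)

text \<open>The means of J_t converge to the mean of the limit law because the tails increase in t,
  so that monotone convergence applies under the tail integral. Hence the limit found in
  \<open>lindley_mean_limit\<close> is the mean of J_\<infinity>.\<close>

lemma mean_stationary:
  "(\<integral>y. integrated_renewal (- y) \<partial>F) =
    (1 - undershoot) * (\<integral>s. s \<partial>interval_measure stationary_cdf)"
proof -
  let ?S = "interval_measure stationary_cdf"
  interpret S: real_distribution ?S by (rule real_distribution_stationary)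
  obtain l where l: "0 \<le> l" "(\<lambda>t. \<integral>\<^sup>+s. ennreal s \<partial>lindley F t) \<longlonglongrightarrow> ennreal l"
    "(\<integral>y. integrated_renewal (- y) \<partial>F) = (1 - undershoot) * l"
    using lindley_mean_limit by blast
  have tail: "emeasure N {x<..} = ennreal (1 - cdf N x)" if "real_distribution N" for N x
  proof -
    interpret N: real_distribution N by fact
    show ?thesis
      using N.prob_compl[of "{..x}"]
      by (simp add: cdf_def Compl_eq_Diff_UNIV[symmetric] N.emeasure_eq_measure)
  qed
  have "(\<lambda>t. \<integral>\<^sup>+x. indicator {0..} x * emeasure (lindley F t) {x<..} \<partial>lborel) \<longlonglongrightarrow>
      (\<integral>\<^sup>+x. indicator {0..} x * emeasure ?S {x<..} \<partial>lborel)"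
    unfolding tail[OF real_distribution_lindley] tail[OF real_distribution_stationary] cdf_stationary
  proof (rule nn_integral_LIMSEQ)
    show "incseq (\<lambda>t x. indicator {0..} x * ennreal (1 - cdf (lindley F t) x))"
      using cdf_lindley_decreasing
      by (auto simp: incseq_def decseq_def le_fun_def intro!: mult_left_mono ennreal_leI)
    show "(\<lambda>t. indicator {0..} x * ennreal (1 - cdf (lindley F t) x)) \<longlonglongrightarrow>
        indicator {0..} x * ennreal (1 - stationary_cdf x)" for x
      by (intro ennreal_tendsto_cmult tendsto_ennrealI tendsto_intros cdf_lindley_tendsto)
        (auto simp: indicator_def)
    fix t
    interpret L: real_distribution "lindley F t" by (rule real_distribution_lindley)
    have [measurable]: "cdf (lindley F t) \<in> borel_measurable borel"
      by (intro borel_measurable_mono monoI L.cdf_nondecreasing)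
    show "(\<lambda>x. indicator {0..} x * ennreal (1 - cdf (lindley F t) x)) \<in> borel_measurable lborel"
      by measurable
  qed
  then have "(\<lambda>t. \<integral>\<^sup>+s. ennreal s \<partial>lindley F t) \<longlonglongrightarrow> (\<integral>\<^sup>+s. ennreal s \<partial>?S)"
    by (simp add: nn_integral_layer_cake lindley.sigma_finite_measure_axioms S.sigma_finite_measure_axioms)
  then have eq: "(\<integral>\<^sup>+s. ennreal s \<partial>?S) = ennreal l"
    using l(2) by (rule LIMSEQ_unique)
  \<comment> \<open>The limit law has no mass below 0, so its Bochner mean is the nonnegative
    integral just computed.\<close>
  have "(stationary_cdf \<longlongrightarrow> measure ?S {..<0}) (at_left 0)"
    using S.cdf_at_left[of 0] by (simp add: cdf_stationary)
  moreover have "(stationary_cdf \<longlongrightarrow> 0) (at_left 0)"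
    by (rule tendsto_eventually, rule eventually_at_leftI[of "-1"]) (auto simp: stationary_cdf_neg)
  ultimately have "measure ?S {..<0} = 0" by (intro tendsto_unique[of "at_left 0"]) auto
  then have "AE s in ?S. 0 \<le> s"
    by (intro AE_I[of _ _ "{..<0}"]) (auto simp: S.emeasure_eq_measure)
  then have "(\<integral>s. s \<partial>?S) = l"
    using l(1) by (subst integral_eq_nn_integral) (auto simp: eq)
  then show ?thesis using l(3) by simp
qed

end

section \<open>Ladder heights\<close>

text \<open>\<open>G\<close> enters only through its decomposition by ladder period: n steps below
  zero, then a step into \<open>{0..}\<close>. That its mass is one is derived from this.\<close>

locale ladder = net_demand +
  fixes G :: "real measure"
  assumes sets_G [simp, measurable_cong]: "sets G = sets borel"
    and nn_integral_G: "f \<in> borel_measurable borel \<Longrightarrow> (\<integral>\<^sup>+z. f z \<partial>G) =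
      (\<Sum>n. \<integral>\<^sup>+t. \<integral>\<^sup>+y. f (t + y) * indicator {0..} (t + y) \<partial>F \<partial>killed_law F {..<0} n)"
begin

text \<open>The one-step splits summed over all times before the ladder period; \<open>f 0\<close>
  is the term at time 0. In additive form it holds for every nonnegative measurable
  \<open>f\<close>, infinite values included.\<close>

lemma dynkin:
  assumes [measurable]: "f \<in> borel_measurable borel"
  shows "f 0 + (\<Sum>n. \<integral>\<^sup>+t. \<integral>\<^sup>+y. f (t + y) \<partial>F \<partial>killed_law F {..<0} n) =
    (\<Sum>n. \<integral>\<^sup>+t. f t \<partial>killed_law F {..<0} n) + (\<integral>\<^sup>+z. f z \<partial>G)"
proof -
  have "(\<Sum>n. \<integral>\<^sup>+t. \<integral>\<^sup>+y. f (t + y) \<partial>F \<partial>killed_law F {..<0} n) =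
    (\<Sum>n. \<integral>\<^sup>+t. f t \<partial>killed_law F {..<0} (Suc n)) + (\<integral>\<^sup>+z. f z \<partial>G)"
    by (simp add: nn_integral_convolution_split nn_integral_G suminf_add del: killed_law.simps(2))
  moreover have "(\<Sum>n. \<integral>\<^sup>+t. f t \<partial>killed_law F {..<0} n) =
      (\<Sum>n. \<integral>\<^sup>+t. f t \<partial>killed_law F {..<0} (Suc n)) + f 0"
    by (subst ennreal_suminf_head) (simp add: nn_integral_return del: killed_law.simps(2))
  ultimately show ?thesis by (simp add: ac_simps)
qed

lemma total_ge_1: "1 \<le> total"
proof -
  have "1 \<le> ennreal total"
    unfolding ennreal_total by (subst ennreal_suminf_head) (simp del: killed_law.simps(2))
  then show ?thesis by (simp add: total_def flip: ennreal_1)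
qed

text \<open>Dynkin's formula for the constant 1: the mean ladder period occurs on both sides, is
  finite, and cancels.\<close>

lemma prob_space_G: "prob_space G"
proof
  have "1 + ennreal total = ennreal total + emeasure G UNIV"
    using dynkin[of "\<lambda>_. 1"] emeasure_space_1 sets_eq_imp_space_eq[OF sets_G]
    by (simp add: ennreal_total)
  then have "emeasure G UNIV = 1"
    by (simp add: add.commute[of 1] ennreal_add_left_cancel)
  then show "emeasure G (space G) = 1"
    using sets_eq_imp_space_eq[OF sets_G] by simp
qed

end

sublocale ladder \<subseteq> G: prob_space G by (rule prob_space_G)

context ladder
begin

lemma AE_G: "AE z in G. 0 \<le> z"
proof -
  have "(\<integral>\<^sup>+z. indicator {..<0} z \<partial>G) = 0"
  proof -
    have "indicator {..<0} z * indicator {0..} z = (0 :: ennreal)" for z :: real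
      by (simp add: indicator_def)
    then show ?thesis by (simp only: nn_integral_G borel_measurable_indicator lessThan_borel) simp
  qed
  then have "emeasure G {..<0} = 0" by simp
  then show ?thesis
    using sets_eq_imp_space_eq[OF sets_G] by (intro AE_I[of _ _ "{..<0}"]) auto
qed

text \<open>Summed over n, the factorisation lets i and k = n - i range independently: the sum over
  k assembles the law \<open>G\<close>, the sum over i the function U.\<close>

lemma renewal_equation_ennreal:
  "ennreal (renewal x) = indicator {0..} x + (\<integral>\<^sup>+z. ennreal (renewal (x - z)) \<partial>G)"
proof -
  \<comment> \<open>The factorisation needs a function vanishing below 0, hence [0,x] instead of
    (-\<infinity>,x]; on the nonnegative positions of walk and ladder heights the two agree.\<close>
  define f :: "real \<Rightarrow> ennreal" where "f = indicator {0..x}"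
  have [measurable]: "f \<in> borel_measurable borel" by (simp add: f_def)
  have neg: "f z = 0" if "z < 0" for z using that by (simp add: f_def)
  have u: "emeasure (killed_law F {0..} n) {..x - z} = (\<integral>\<^sup>+s. f (s + z) \<partial>killed_law F {0..} n)"
    if "0 \<le> z" for n z
  proof -
    have "emeasure (killed_law F {0..} n) {..x - z} = (\<integral>\<^sup>+s. indicator {..x - z} s \<partial>killed_law F {0..} n)"
      by simp
    also have "\<dots> = (\<integral>\<^sup>+s. f (s + z) \<partial>killed_law F {0..} n)"
      by (rule nn_integral_cong_AE, rule eventually_mono[OF AE_pos])
        (use that in \<open>auto simp: f_def indicator_def\<close>)
    finally show ?thesis .
  qed
  have "ennreal (renewal x) = (\<Sum>n. \<integral>\<^sup>+s. f s \<partial>killed_law F {0..} n)"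
    using u[of 0] by (simp add: ennreal_renewal)
  also have "\<dots> = (\<Sum>n. \<integral>\<^sup>+s. f s \<partial>killed_law F {0..} (Suc n)) + f 0"
    by (subst ennreal_suminf_head) (simp add: nn_integral_return del: killed_law.simps(2))
  also have "(\<Sum>n. \<integral>\<^sup>+s. f s \<partial>killed_law F {0..} (Suc n)) =
    (\<Sum>i. \<Sum>k. \<integral>\<^sup>+s. \<integral>\<^sup>+t. \<integral>\<^sup>+y. f (s + (t + y)) * indicator {0..} (t + y) \<partial>F
       \<partial>killed_law F {..<0} k \<partial>killed_law F {0..} i)"
    by (simp only: wiener_hopf[OF \<open>f \<in> borel_measurable borel\<close> neg]) (rule ennreal_suminf_triangle)
  also have "\<dots> = (\<Sum>i. \<integral>\<^sup>+s. \<integral>\<^sup>+z. f (s + z) \<partial>G \<partial>killed_law F {0..} i)"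
    by (simp add: nn_integral_G nn_integral_suminf)
  also have "\<dots> = (\<Sum>i. \<integral>\<^sup>+z. \<integral>\<^sup>+s. f (s + z) \<partial>killed_law F {0..} i \<partial>G)"
  proof (intro arg_cong[where f = suminf] ext)
    fix i
    interpret P: pair_sigma_finite "killed_law F {0..} i" G ..
    show "(\<integral>\<^sup>+s. \<integral>\<^sup>+z. f (s + z) \<partial>G \<partial>killed_law F {0..} i) =
      (\<integral>\<^sup>+z. \<integral>\<^sup>+s. f (s + z) \<partial>killed_law F {0..} i \<partial>G)"
      by (rule P.Fubini'[symmetric]) measurable
  qed
  also have "\<dots> = (\<integral>\<^sup>+z. (\<Sum>i. \<integral>\<^sup>+s. f (s + z) \<partial>killed_law F {0..} i) \<partial>G)"
    by (rule nn_integral_suminf[symmetric]) measurable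
  also have "\<dots> = (\<integral>\<^sup>+z. ennreal (renewal (x - z)) \<partial>G)"
    by (rule nn_integral_cong_AE, rule eventually_mono[OF AE_G]) (simp add: ennreal_renewal u)
  finally show ?thesis by (simp add: f_def indicator_def add.commute)
qed

lemma suminf_killed_law_exp_bound:
  assumes "\<And>t. t \<le> 0 \<Longrightarrow> f t \<le> ennreal (K * exp (- \<epsilon> * t))" "0 < \<epsilon>" "laplace \<epsilon> < 1" "0 \<le> K"
  shows "(\<Sum>n. \<integral>\<^sup>+t. f t \<partial>killed_law F {..<0} n) < \<infinity>"
proof -
  have "(\<Sum>n. \<integral>\<^sup>+t. f t \<partial>killed_law F {..<0} n)
      \<le> (\<Sum>n. ennreal K * (\<integral>\<^sup>+t. ennreal (exp (- \<epsilon> * t)) \<partial>killed_law F {..<0} n))"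
    by (intro suminf_le, subst nn_integral_cmult[symmetric], simp, rule nn_integral_mono_AE,
        rule eventually_mono[OF AE_neg])
      (use assms in \<open>auto simp: ennreal_mult'[symmetric]\<close>)
  also have "\<dots> \<le> ennreal K * ennreal (1 / (1 - laplace \<epsilon>))"
    unfolding ennreal_suminf_cmult using assms
    by (intro mult_left_mono suminf_killed_law_laplace) auto
  also have "\<dots> < \<infinity>" by (simp add: ennreal_mult_less_top)
  finally show ?thesis .
qed

text \<open>Dynkin's formula for the test function \<open>t \<mapsto> U(-t)\<close>.\<close>

lemma total_undershoot: "total * (1 - undershoot) = 1"
proof -
  obtain \<epsilon> where e: "0 < \<epsilon>" "laplace \<epsilon> < 1" using laplace_lt_1[of 1] by auto
  define f where "f t = ennreal (renewal (- t))" for t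
  have [measurable]: "f \<in> borel_measurable borel" unfolding f_def by measurable
  let ?V = "\<lambda>f :: real \<Rightarrow> ennreal. \<Sum>n. \<integral>\<^sup>+t. f t \<partial>killed_law F {..<0} n"
  define P where "P t = (\<integral>\<^sup>+y. f (t + y) \<partial>F)" for t
  have [measurable]: "P \<in> borel_measurable borel" unfolding P_def by measurable
  have fin: "?V f < \<infinity>"
    using e renewal_le_exp[OF e, of "- t" for t]
    by (intro suminf_killed_law_exp_bound[of _ "1 / (1 - laplace \<epsilon>)" \<epsilon>])
      (auto simp: f_def intro!: ennreal_leI)
  \<comment> \<open>At x = 0 the renewal equation expresses \<open>f 0\<close> by the ladder term,
    which is finite and cancels from Dynkin's formula: \<open>1 + ?V P = ?V f\<close>.\<close>
  have f0: "f 0 = 1 + (\<integral>\<^sup>+z. f z \<partial>G)"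
    using renewal_equation_ennreal[of 0] by (simp add: f_def)
  have fG: "(\<integral>\<^sup>+z. f z \<partial>G) < \<infinity>"
  proof -
    have "(\<integral>\<^sup>+z. f z \<partial>G) \<le> f 0" by (simp add: f0)
    then show ?thesis by (simp add: f_def le_less_trans)
  qed
  have "f 0 + ?V P = ?V f + (\<integral>\<^sup>+z. f z \<partial>G)"
    unfolding P_def by (rule dynkin) measurable
  then have "(\<integral>\<^sup>+z. f z \<partial>G) + (1 + ?V P) = (\<integral>\<^sup>+z. f z \<partial>G) + ?V f"
    by (simp add: f0 ac_simps)
  then have Vf: "1 + ?V P = ?V f"
    using fG by (auto simp: ennreal_add_left_cancel)
  \<comment> \<open>The walk lives on t \<le> 0, so the one-step equation for U holds at -t. Summed
    over time, its constants 1 and \<open>undershoot\<close> are each counted \<open>total\<close>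
    times.\<close>
  have "?V (\<lambda>t. 1 + P t) = ?V (\<lambda>t. f t + ennreal undershoot)"
  proof (intro arg_cong[where f = suminf] ext nn_integral_cong_AE)
    fix n
    show "AE t in killed_law F {..<0} n. 1 + P t = f t + ennreal undershoot"
      using AE_neg
    proof eventually_elim
      case (elim t)
      then show ?case using renewal_convolution_ennreal[of "-t"] by (simp add: P_def f_def)
    qed
  qed
  then have "ennreal total + ?V P = ?V f + ennreal undershoot * ennreal total"
    by (simp add: nn_integral_add suminf_add[symmetric] ennreal_total)
  then have "?V P + ennreal total = ?V P + (1 + ennreal undershoot * ennreal total)"
    by (simp add: Vf[symmetric] ac_simps)
  moreover have "?V P < \<infinity>" using fin Vf by (metis add.commute ennreal_add_less_top infinity_ennreal_def)
  ultimately have "ennreal total = 1 + ennreal undershoot * ennreal total"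
    by (auto simp: ennreal_add_left_cancel)
  also have "\<dots> = ennreal (1 + undershoot * total)"
    using undershoot_nonneg total_ge_1 by (simp add: ennreal_mult')
  finally have "total = 1 + undershoot * total"
    using undershoot_nonneg total_ge_1 by (subst (asm) ennreal_inj) auto
  then show ?thesis by (simp add: algebra_simps)
qed

text \<open>Wald's identity, from Dynkin's formula for the positive and the negative part.\<close>

lemma nn_integral_ladder_height: "(\<integral>\<^sup>+z. ennreal z \<partial>G) = ennreal (mu * total)"
proof -
  obtain \<epsilon> where e: "0 < \<epsilon>" "laplace \<epsilon> < 1" using laplace_lt_1[of 1] by auto
  have mu: "0 < mu" using mean_pos by (simp add: mu_def)
  define p :: "real \<Rightarrow> ennreal" where "p t = ennreal t" for t
  define m :: "real \<Rightarrow> ennreal" where "m t = ennreal (- t)" for t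
  have [measurable]: "p \<in> borel_measurable borel" "m \<in> borel_measurable borel"
    unfolding p_def m_def by measurable
  let ?V = "\<lambda>f :: real \<Rightarrow> ennreal. \<Sum>n. \<integral>\<^sup>+t. f t \<partial>killed_law F {..<0} n"
  define Pp where "Pp t = (\<integral>\<^sup>+y. p (t + y) \<partial>F)" for t
  define Pm where "Pm t = (\<integral>\<^sup>+y. m (t + y) \<partial>F)" for t
  have [measurable]: "Pp \<in> borel_measurable borel" "Pm \<in> borel_measurable borel"
    unfolding Pp_def Pm_def by measurable
  \<comment> \<open>Before the ladder period the walk has no positive part and at it no negative
    part: Dynkin's formula gives \<open>?V Pp\<close> as the mean ladder height and
    \<open>?V Pm\<close> as \<open>?V m\<close>.\<close>
  have "?V p = 0"
  proof -
    have "(\<integral>\<^sup>+t. p t \<partial>killed_law F {..<0} n) = (\<integral>\<^sup>+t. 0 \<partial>killed_law F {..<0} n)" for n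
      by (rule nn_integral_cong_AE, rule eventually_mono[OF AE_neg]) (simp add: p_def ennreal_neg)
    then show ?thesis by simp
  qed
  then have p: "?V Pp = (\<integral>\<^sup>+z. ennreal z \<partial>G)"
    using dynkin[of p] by (simp add: Pp_def p_def)
  have "(\<integral>\<^sup>+z. m z \<partial>G) = (\<integral>\<^sup>+z. 0 \<partial>G)"
    by (rule nn_integral_cong_AE, rule eventually_mono[OF AE_G]) (simp add: m_def ennreal_neg)
  then have m: "?V Pm = ?V m"
    using dynkin[of m] by (simp add: Pm_def m_def)
  have fin: "?V m < \<infinity>"
  proof (rule suminf_killed_law_exp_bound[of _ "1 / \<epsilon>" \<epsilon>])
    fix t :: real
    have "\<epsilon> * (- t) \<le> exp (\<epsilon> * (- t))" using exp_ge_add_one_self[of "\<epsilon> * (- t)"] by linarith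
    then show "m t \<le> ennreal (1 / \<epsilon> * exp (- \<epsilon> * t))"
      using e by (auto simp: m_def field_simps intro!: ennreal_leI)
  qed (use e in auto)
  \<comment> \<open>The means of the two parts of t + Y differ by t + mu, and \<open>m t\<close> is
    -t for t \<le> 0.\<close>
  have "?V (\<lambda>t. Pp t + m t) = ?V (\<lambda>t. Pm t + ennreal mu)"
  proof (intro arg_cong[where f = suminf] ext nn_integral_cong_AE)
    fix n
    show "AE t in killed_law F {..<0} n. Pp t + m t = Pm t + ennreal mu"
      using AE_neg
    proof eventually_elim
      case (elim t)
      have int: "integrable F (\<lambda>y. max 0 (t + y))" "integrable F (\<lambda>y. max 0 (- (t + y)))"
        using integrable_id by (auto intro!: integrable_max)
      have "Pp t = (\<integral>\<^sup>+y. ennreal (max 0 (t + y)) \<partial>F)"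
        unfolding Pp_def p_def by (intro nn_integral_cong) (auto simp: max_def ennreal_neg)
      also have "\<dots> = ennreal (\<integral>y. max 0 (t + y) \<partial>F)"
        by (intro nn_integral_eq_integral int) auto
      finally have 1: "Pp t = ennreal (\<integral>y. max 0 (t + y) \<partial>F)" .
      have "Pm t = (\<integral>\<^sup>+y. ennreal (max 0 (- (t + y))) \<partial>F)"
        unfolding Pm_def m_def by (intro nn_integral_cong) (auto simp: max_def ennreal_neg)
      also have "\<dots> = ennreal (\<integral>y. max 0 (- (t + y)) \<partial>F)"
        by (intro nn_integral_eq_integral int) auto
      finally have 2: "Pm t = ennreal (\<integral>y. max 0 (- (t + y)) \<partial>F)" .
      have "(\<integral>y. max 0 (t + y) \<partial>F) - (\<integral>y. max 0 (- (t + y)) \<partial>F) = (\<integral>y. t + y \<partial>F)"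
          unfolding Bochner_Integration.integral_diff[OF int, symmetric]
        by (intro Bochner_Integration.integral_cong) auto
      also have "\<dots> = t + mu"
        using integrable_id by (simp add: mu_def prob_space[simplified])
      finally have "(\<integral>y. max 0 (t + y) \<partial>F) + - t = (\<integral>y. max 0 (- (t + y)) \<partial>F) + mu" by simp
      moreover have "0 \<le> (\<integral>y. max 0 (t + y) \<partial>F)" "0 \<le> (\<integral>y. max 0 (- (t + y)) \<partial>F)"
        by (intro integral_nonneg_AE; simp)+
      ultimately show ?case
        using elim mu unfolding 1 2 m_def by (simp add: ennreal_plus[symmetric] del: ennreal_plus)
    qed
  qed
  then have "?V Pp + ?V m = ?V Pm + ennreal mu * ennreal total"
    by (simp add: nn_integral_add suminf_add[symmetric] ennreal_total)
  then have "?V m + (\<integral>\<^sup>+z. ennreal z \<partial>G) = ?V m + ennreal mu * ennreal total"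
    by (simp add: m p ac_simps)
  then show ?thesis
    using fin mu total_ge_1 by (auto simp: ennreal_add_left_cancel ennreal_mult')
qed

lemma mean_ladder_height: "(\<integral>z. z \<partial>G) = mu * total" "(\<integral>z. z \<partial>G) * (1 - undershoot) = mu"
proof -
  show "(\<integral>z. z \<partial>G) = mu * total"
    using nn_integral_ladder_height mean_pos total_ge_1
    by (subst integral_eq_nn_integral) (auto simp: AE_G mu_def)
  then show "(\<integral>z. z \<partial>G) * (1 - undershoot) = mu"
    using total_undershoot by simp
qed

section \<open>The renewal series of the ladder heights\<close>

lemma sets_convolution_power: "sets (convolution_power G n) = sets borel"
  by (cases n) auto

lemma prob_space_convolution_power: "prob_space (convolution_power G n)"
proof (induction n)
  case 0
  show ?case by (simp add: prob_space_return)
next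
  case (Suc n)
  note [measurable_cong] = sets_convolution_power
  interpret C: prob_space "convolution_power G n" by (rule Suc)
  interpret P: pair_prob_space G "convolution_power G n" ..
  show ?case unfolding convolution_power.simps convolution_def
    by (rule P.prob_space_distr) measurable
qed

lemma nn_integral_convolution_power_Suc:
  assumes [measurable]: "f \<in> borel_measurable borel"
  shows "(\<integral>\<^sup>+x. f x \<partial>convolution_power G (Suc n)) = (\<integral>\<^sup>+z. \<integral>\<^sup>+x. f (z + x) \<partial>convolution_power G n \<partial>G)"
proof -
  interpret C: prob_space "convolution_power G n" by (rule prob_space_convolution_power)
  show ?thesis unfolding convolution_power.simps
    by (rule nn_integral_convolution) (auto simp: sets_convolution_power G.finite_measure_axioms C.finite_measure_axioms)
qed

lemma AE_convolution_power: "AE s in convolution_power G n. 0 \<le> s"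
proof (induction n)
  case 0
  show ?case unfolding convolution_power.simps by (subst AE_return) simp_all
next
  case (Suc n)
  note [measurable_cong] = sets_convolution_power
  interpret C: prob_space "convolution_power G n" by (rule prob_space_convolution_power)
  have "emeasure (convolution_power G (Suc n)) {..<0} =
      (\<integral>\<^sup>+x. indicator {..<0} x \<partial>convolution_power G (Suc n))"
    by (simp add: sets_convolution_power)
  also have "\<dots> = (\<integral>\<^sup>+z. \<integral>\<^sup>+x. indicator {..<0} (z + x) \<partial>convolution_power G n \<partial>G)"
    by (rule nn_integral_convolution_power_Suc) simp
  also have "\<dots> = (\<integral>\<^sup>+z. 0 \<partial>G)"
  proof (rule nn_integral_cong_AE, rule eventually_mono[OF AE_G])
    fix z :: real assume "0 \<le> z"
    have "(\<integral>\<^sup>+x. indicator {..<0} (z + x) \<partial>convolution_power G n) = (\<integral>\<^sup>+x. 0 \<partial>convolution_power G n)"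
      by (rule nn_integral_cong_AE, rule eventually_mono[OF Suc])
        (use \<open>0 \<le> z\<close> in \<open>auto simp: indicator_def\<close>)
    then show "(\<integral>\<^sup>+x. indicator {..<0} (z + x) \<partial>convolution_power G n) = 0" by simp
  qed
  finally show ?case
    using sets_eq_imp_space_eq[OF sets_convolution_power[of "Suc n"]]
    by (intro AE_I[of _ _ "{..<0}"]) (auto simp: sets_convolution_power)
qed

lemma renewal_iterate:
  "ennreal (renewal x) = (\<Sum>k<n. emeasure (convolution_power G k) {..x}) +
     (\<integral>\<^sup>+s. ennreal (renewal (x - s)) \<partial>convolution_power G n)"
proof (induction n arbitrary: x)
  case 0
  show ?case by (simp add: nn_integral_return)
next
  case (Suc n)
  note [measurable_cong] = sets_convolution_power
  interpret C: prob_space "convolution_power G k" for k by (rule prob_space_convolution_power)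
  have em: "emeasure (convolution_power G k) {..x - z} =
      (\<integral>\<^sup>+s. indicator {..x} (z + s) \<partial>convolution_power G k)" for k z
  proof -
    have "(\<integral>\<^sup>+s. indicator {..x} (z + s) \<partial>convolution_power G k) =
        (\<integral>\<^sup>+s. indicator {..x - z} s \<partial>convolution_power G k)"
      by (intro nn_integral_cong) (auto simp: indicator_def)
    then show ?thesis by (simp add: sets_convolution_power)
  qed
  have shift: "(\<integral>\<^sup>+z. emeasure (convolution_power G k) {..x - z} \<partial>G) = emeasure (convolution_power G (Suc k)) {..x}" for k
    using nn_integral_convolution_power_Suc[of "indicator {..x}" k]
    by (simp add: em sets_convolution_power del: convolution_power.simps)
  have meas: "(\<lambda>z. emeasure (convolution_power G k) {..x - z}) \<in> borel_measurable borel" for k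
    unfolding em by measurable
  have "ennreal (renewal x) = indicator {0..} x + (\<integral>\<^sup>+z. ennreal (renewal (x - z)) \<partial>G)"
    by (rule renewal_equation_ennreal)
  also have "(\<integral>\<^sup>+z. ennreal (renewal (x - z)) \<partial>G) =
     (\<integral>\<^sup>+z. (\<Sum>k<n. emeasure (convolution_power G k) {..x - z}) +
       (\<integral>\<^sup>+s. ennreal (renewal (x - z - s)) \<partial>convolution_power G n) \<partial>G)"
    by (subst Suc) simp
  also have "\<dots> = (\<Sum>k<n. emeasure (convolution_power G (Suc k)) {..x}) +
       (\<integral>\<^sup>+z. \<integral>\<^sup>+s. ennreal (renewal (x - (z + s))) \<partial>convolution_power G n \<partial>G)"
    by (subst nn_integral_add)
      (use meas in \<open>auto simp: nn_integral_sum shift algebra_simps simp del: convolution_power.simps intro!: borel_measurable_sum\<close>)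
  also have "(\<integral>\<^sup>+z. \<integral>\<^sup>+s. ennreal (renewal (x - (z + s))) \<partial>convolution_power G n \<partial>G) =
      (\<integral>\<^sup>+s. ennreal (renewal (x - s)) \<partial>convolution_power G (Suc n))"
    by (rule nn_integral_convolution_power_Suc[symmetric]) measurable
  also have "(indicator {0..} x :: ennreal) = emeasure (convolution_power G 0) {..x}"
    by (simp add: indicator_def)
  finally show ?case
    by (simp add: sum.lessThan_Suc_shift add.assoc del: convolution_power.simps sum.lessThan_Suc)
qed

text \<open>The remainder after n substitutions of the renewal equation is at most U(x) times the
  n-th term of the series, since U is increasing and zero below 0. The terms tend to 0 because the
  partial sums are bounded by U(x).\<close>

lemma suminf_cdf_convolution_power: "(\<Sum>n. cdf (convolution_power G n) x) = renewal x"
proof -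
  note [measurable_cong] = sets_convolution_power
  interpret C: prob_space "convolution_power G k" for k by (rule prob_space_convolution_power)
  let ?c = "\<lambda>n. cdf (convolution_power G n) x"
  have c: "emeasure (convolution_power G n) {..x} = ennreal (?c n)" for n
    by (simp add: cdf_def C.emeasure_eq_measure)
  have c0: "0 \<le> ?c n" for n by (simp add: cdf_def)
  have lower: "(\<Sum>k<n. ?c k) \<le> renewal x" for n
  proof -
    have "ennreal (\<Sum>k<n. ?c k) \<le> ennreal (renewal x)"
      unfolding renewal_iterate[of x n] c by (simp add: c0)
    then show ?thesis by (simp add: renewal_nonneg)
  qed
  then have sm: "summable ?c" by (intro summableI_nonneg_bounded c0)
  have "renewal x \<le> (\<Sum>k<n. ?c k) + renewal x * ?c n" for n
  proof -
    have "(\<integral>\<^sup>+s. ennreal (renewal (x - s)) \<partial>convolution_power G n)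
        \<le> (\<integral>\<^sup>+s. ennreal (renewal x) * indicator {..x} s \<partial>convolution_power G n)"
      by (rule nn_integral_mono_AE, rule eventually_mono[OF AE_convolution_power])
        (auto simp: indicator_def renewal_neg intro!: ennreal_leI renewal_mono)
    also have "\<dots> = ennreal (renewal x * ?c n)"
      by (simp add: nn_integral_cmult sets_convolution_power c ennreal_mult' renewal_nonneg)
    finally have "ennreal (renewal x) \<le> ennreal (\<Sum>k<n. ?c k) + ennreal (renewal x * ?c n)"
      unfolding renewal_iterate[of x n] c by (auto simp: c0 sum_nonneg intro!: add_left_mono)
    then show ?thesis
      by (simp add: ennreal_plus[symmetric] c0 sum_nonneg renewal_nonneg del: ennreal_plus)
  qed
  moreover have "(\<lambda>n. (\<Sum>k<n. ?c k) + renewal x * ?c n) \<longlonglongrightarrow> suminf ?c + renewal x * 0"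
    by (intro tendsto_intros summable_LIMSEQ sm summable_LIMSEQ_zero)
  ultimately have "renewal x \<le> suminf ?c"
    using LIMSEQ_le_const[of "\<lambda>n. (\<Sum>k<n. ?c k) + renewal x * ?c n" "suminf ?c" "renewal x"] by simp
  moreover have "suminf ?c \<le> renewal x" by (intro suminf_le_const sm lower)
  ultimately show ?thesis by simp
qed

section \<open>The value function: equation and growth\<close>

definition value_function :: "real \<Rightarrow> real \<Rightarrow> real \<Rightarrow> real" where
  "value_function h p x = h * (\<integral>z. z \<partial>G) / mu * integrated_renewal x - (h + p) * x"

lemma value_function_solves:
  assumes "0 \<le> x"
  shows "set_integrable F {- r..x} (\<lambda>y. value_function h p (x - y))"
    and "value_function h p x = h * (\<integral>y. max (x - y) 0 \<partial>F) + p * (\<integral>y. max (y - x) 0 \<partial>F)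
      - p * (\<integral>y. y \<partial>F) - h * (\<integral>s. s \<partial>interval_measure stationary_cdf)
      + (LINT y:{- r..x}|F. value_function h p (x - y))"
proof -
  define c where "c = h * (\<integral>z. z \<partial>G) / mu"
  \<comment> \<open>\<open>c\<close> is h / \<kappa>, so each factor \<open>1 - undershoot\<close>
    produced by the equation for W turns into h.\<close>
  have c: "c * (1 - undershoot) = h"
  proof -
    have "c * (1 - undershoot) = h * ((\<integral>z. z \<partial>G) * (1 - undershoot)) / mu" by (simp add: c_def)
    then show ?thesis unfolding mean_ladder_height(2) using mean_pos by (simp add: mu_def)
  qed
  \<comment> \<open>\<open>g\<close> continues the integrand from [-r,x] to the whole line: for y >
    x both W and the positive part are zero, and y < -r has probability zero.\<close>
  define g where "g y = c * integrated_renewal (x - y) - (h + p) * max (x - y) 0" for y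
  have int_max: "integrable F (\<lambda>y. max (x - y) 0)" "integrable F (\<lambda>y. max (y - x) 0)"
    using integrable_id by (auto intro!: integrable_max)
  have g: "integrable F g"
    unfolding g_def using integrable_integrated_renewal int_max by auto
  have [measurable]: "value_function h p \<in> borel_measurable borel"
    unfolding value_function_def by measurable
  have AEg: "AE y in F. g y = indicator {- r..x} y *\<^sub>R value_function h p (x - y)"
    using bounded_below
    by eventually_elim
      (auto simp: g_def indicator_def value_function_def c_def integrated_renewal_nonpos)
  have "integrable F (\<lambda>y. indicator {- r..x} y *\<^sub>R value_function h p (x - y))"
    using g by (rule integrable_cong_AE_imp) (use AEg in auto)
  then show "set_integrable F {- r..x} (\<lambda>y. value_function h p (x - y))"
    by (simp add: set_integrable_def)
  have "(LINT y:{- r..x}|F. value_function h p (x - y)) = (\<integral>y. g y \<partial>F)"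
    unfolding set_lebesgue_integral_def using g AEg by (intro integral_cong_AE) auto
  also have "\<dots> = c * (\<integral>y. integrated_renewal (x - y) \<partial>F) - (h + p) * (\<integral>y. max (x - y) 0 \<partial>F)"
    unfolding g_def using integrable_integrated_renewal int_max by simp
  also have "\<dots> = c * integrated_renewal x
      + c * (1 - undershoot) * (\<integral>s. s \<partial>interval_measure stationary_cdf)
      - c * (1 - undershoot) * x - (h + p) * (\<integral>y. max (x - y) 0 \<partial>F)"
    unfolding integrated_renewal_convolution[OF assms] mean_stationary by (simp add: algebra_simps)
  finally have L: "(LINT y:{- r..x}|F. value_function h p (x - y)) = c * integrated_renewal x
      + h * (\<integral>s. s \<partial>interval_measure stationary_cdf) - h * x - (h + p) * (\<integral>y. max (x - y) 0 \<partial>F)"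
    unfolding c .
  \<comment> \<open>From (y - x)^+ - (x - y)^+ = y - x the lost-sales cost becomes a holding term
    plus a linear one; all terms with p then reduce to -p x.\<close>
  have "(\<integral>y. max (y - x) 0 \<partial>F) - (\<integral>y. max (x - y) 0 \<partial>F) = (\<integral>y. y - x \<partial>F)"
    unfolding Bochner_Integration.integral_diff[OF int_max(2,1), symmetric]
    by (intro Bochner_Integration.integral_cong) auto
  also have "\<dots> = (\<integral>y. y \<partial>F) - x"
    using integrable_id by (simp add: prob_space[simplified])
  finally have P: "(\<integral>y. max (y - x) 0 \<partial>F) = (\<integral>y. max (x - y) 0 \<partial>F) + (\<integral>y. y \<partial>F) - x" by simp
  show "value_function h p x = h * (\<integral>y. max (x - y) 0 \<partial>F) + p * (\<integral>y. max (y - x) 0 \<partial>F)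
      - p * (\<integral>y. y \<partial>F) - h * (\<integral>s. s \<partial>interval_measure stationary_cdf)
      + (LINT y:{- r..x}|F. value_function h p (x - y))"
    unfolding L P by (simp add: value_function_def c_def algebra_simps)
qed

text \<open>W is bounded by a multiple of exp(\<epsilon> x) whenever
  \<open>laplace \<epsilon> < 1\<close>, and such \<epsilon> > 0 exist below every \<delta>; the
  linear term uses \<epsilon> x \<le> exp(\<epsilon> x).\<close>

lemma subexponential_value_function: "subexponential (value_function h p)"
  unfolding subexponential_def
proof (intro allI impI)
  fix \<delta> :: real assume "0 < \<delta>"
  then obtain \<epsilon> where e: "0 < \<epsilon>" "\<epsilon> < \<delta>" "laplace \<epsilon> < 1" using laplace_lt_1 by blast
  define c where "c = h * (\<integral>z. z \<partial>G) / mu"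
  define b where "b = 1 / (\<epsilon> * (1 - laplace \<epsilon>))"
  show "\<exists>K. \<forall>x\<ge>0. \<bar>value_function h p x\<bar> \<le> K * exp (\<delta> * x)"
  proof (intro exI allI impI)
    fix x :: real assume x: "0 \<le> x"
    have le: "exp (\<epsilon> * x) \<le> exp (\<delta> * x)" using e x by (simp add: mult_right_mono)
    have "integrated_renewal x \<le> b * exp (\<epsilon> * x)"
      using integrated_renewal_le_exp[OF e(1,3) x] by (simp add: b_def)
    also have "\<dots> \<le> b * exp (\<delta> * x)"
      using e le by (intro mult_left_mono) (auto simp: b_def)
    finally have 1: "\<bar>c * integrated_renewal x\<bar> \<le> \<bar>c\<bar> * (b * exp (\<delta> * x))"
      unfolding abs_mult by (intro mult_left_mono) (simp_all add: integrated_renewal_nonneg)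
    have "\<epsilon> * x \<le> exp (\<epsilon> * x)" using exp_ge_add_one_self[of "\<epsilon> * x"] by linarith
    then have "\<epsilon> * x \<le> exp (\<delta> * x)" using le by (rule order_trans)
    then have "x \<le> 1 / \<epsilon> * exp (\<delta> * x)" using e by (simp add: field_simps)
    then have 2: "\<bar>(h + p) * x\<bar> \<le> \<bar>h + p\<bar> * (1 / \<epsilon> * exp (\<delta> * x))"
      unfolding abs_mult using x by (intro mult_left_mono) auto
    have "\<bar>value_function h p x\<bar> \<le> \<bar>c * integrated_renewal x\<bar> + \<bar>(h + p) * x\<bar>"
      unfolding value_function_def c_def[symmetric] by (rule abs_triangle_ineq4)
    also have "\<dots> \<le> (\<bar>c\<bar> * b + \<bar>h + p\<bar> / \<epsilon>) * exp (\<delta> * x)"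
      using 1 2 by (simp add: algebra_simps)
    finally show "\<bar>value_function h p x\<bar> \<le> (\<bar>c\<bar> * b + \<bar>h + p\<bar> / \<epsilon>) * exp (\<delta> * x)" .
  qed
qed

end

section \<open>Laws of the inventory level and of the ladder height\<close>

locale demand_process = prob_space M + walk: net_demand F r
  for M :: "'a measure" and F :: "real measure" and r :: real +
  fixes Dt :: "nat \<Rightarrow> 'a \<Rightarrow> real"
  assumes indep: "indep_vars (\<lambda>_. borel) Dt UNIV"
    and law: "\<And>t. distr M borel (\<lambda>\<omega>. Dt t \<omega> - r) = F"
begin

lemma Dt_measurable [measurable]: "Dt t \<in> borel_measurable M"
  using indep by (auto simp: indep_vars_def)

text \<open>Independence of past and next demand as a product law. The index set is left open
  because the two processes count differently: the inventory at t has seen the demands in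
  \<open>{..<t}\<close>, the walk after n steps those in \<open>{1..n}\<close>.\<close>

lemma distr_past_next:
  assumes "t \<notin> I"
  shows "distr M (PiM I (\<lambda>_. borel) \<Otimes>\<^sub>M borel) (\<lambda>\<omega>. (restrict (\<lambda>i. Dt i \<omega>) I, Dt t \<omega> - r)) =
    distr M (PiM I (\<lambda>_. borel)) (\<lambda>\<omega>. restrict (\<lambda>i. Dt i \<omega>) I) \<Otimes>\<^sub>M F"
proof -
  let ?R = "\<lambda>I \<omega>. restrict (\<lambda>i. Dt i \<omega>) I"
  let ?P = "\<lambda>I. PiM I (\<lambda>_. borel :: real measure)"
  have [measurable]: "?R I \<in> measurable M (?P I)" for I by measurable
  have next_law: "distr (distr M (?P {t}) (?R {t})) borel (\<lambda>x. x t - r) = F"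
    unfolding law[of t, symmetric] by (subst distr_distr) (auto simp: comp_def)
  have "indep_var (?P I) (?R I) (?P {t}) (?R {t})"
    using assms by (intro indep_var_restrict[OF indep]) auto
  then have "distr M (?P I) (?R I) \<Otimes>\<^sub>M distr M (?P {t}) (?R {t}) =
      distr M (?P I \<Otimes>\<^sub>M ?P {t}) (\<lambda>\<omega>. (?R I \<omega>, ?R {t} \<omega>))"
    unfolding indep_var_distribution_eq by blast
  then have "distr (distr M (?P I) (?R I) \<Otimes>\<^sub>M distr M (?P {t}) (?R {t})) (?P I \<Otimes>\<^sub>M borel)
      (\<lambda>(x, z). (x, z t - r)) =
    distr M (?P I \<Otimes>\<^sub>M borel) (\<lambda>\<omega>. (?R I \<omega>, Dt t \<omega> - r))"
    by (simp only:) (subst distr_distr, auto simp: comp_def)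
  moreover have "distr (distr M (?P I) (?R I) \<Otimes>\<^sub>M distr M (?P {t}) (?R {t})) (?P I \<Otimes>\<^sub>M borel)
      (\<lambda>(x, z). (x, z t - r)) =
    distr (distr M (?P I) (?R I)) (?P I) (\<lambda>x. x) \<Otimes>\<^sub>M F"
    unfolding next_law[symmetric]
    by (rule pair_measure_distr[symmetric])
      (auto simp: next_law intro: walk.sigma_finite_measure_axioms)
  ultimately show ?thesis by (simp add: distr_distr comp_def)
qed

text \<open>With the coordinate maps as demands, \<open>inventory\<close> is the deterministic
  function of the past through which J_t factors; this separates J_t from the next demand.\<close>

lemma inventory_measurable_PiM:
  "t \<le> n \<Longrightarrow> inventory (\<lambda>i x. x i) r t \<in> borel_measurable (PiM {..<n} (\<lambda>_. borel))"
proof (induction t)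
  case 0
  have "inventory (\<lambda>i x. x i) r 0 = (\<lambda>x. 0)" by auto
  then show ?case by simp
next
  case (Suc t)
  then have [measurable]: "inventory (\<lambda>i x. x i) r t \<in> borel_measurable (PiM {..<n} (\<lambda>_. borel))"
    by simp
  have [measurable]: "(\<lambda>x. x t) \<in> borel_measurable (PiM {..<n} (\<lambda>_. borel))"
    using Suc.prems by (intro measurable_component_singleton) simp
  have "inventory (\<lambda>i x. x i) r (Suc t) = (\<lambda>x. max (inventory (\<lambda>i x. x i) r t x + r - x t) 0)" by auto
  then show ?case by simp
qed

lemma inventory_restrict:
  "t \<le> n \<Longrightarrow> inventory Dt r t \<omega> = inventory (\<lambda>i x. x i) r t (restrict (\<lambda>i. Dt i \<omega>) {..<n})"
  by (induction t) auto

lemma distr_inventory: "distr M borel (inventory Dt r t) = lindley F t"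
proof (induction t)
  case 0
  have "inventory Dt r 0 = (\<lambda>\<omega>. 0)" by auto
  then show ?case by (simp add: distr_const)
next
  case (Suc t)
  let ?R = "\<lambda>\<omega>. restrict (\<lambda>i. Dt i \<omega>) {..<t}"
  let ?J = "inventory (\<lambda>i x. x i) r t"
  let ?P = "PiM {..<t} (\<lambda>_. borel :: real measure)"
  have [measurable]: "?J \<in> borel_measurable ?P" by (rule inventory_measurable_PiM) simp
  have [measurable]: "?R \<in> measurable M ?P" by measurable
  interpret R: prob_space "distr M ?P ?R" by (rule prob_space_distr) measurable
  have J: "distr (distr M ?P ?R) borel ?J = lindley F t"
    unfolding Suc.IH[symmetric] by (subst distr_distr) (auto simp: comp_def inventory_restrict[of t t, symmetric] cong: distr_cong)
  have "inventory Dt r (Suc t) = (\<lambda>(x, y). max (?J x - y) 0) \<circ> (\<lambda>\<omega>. (?R \<omega>, Dt t \<omega> - r))"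
    by (auto simp: inventory_restrict[of t t] fun_eq_iff)
  then have "distr M borel (inventory Dt r (Suc t)) =
      distr (distr M (?P \<Otimes>\<^sub>M borel) (\<lambda>\<omega>. (?R \<omega>, Dt t \<omega> - r))) borel (\<lambda>(x, y). max (?J x - y) 0)"
    by (simp only:) (rule distr_distr[symmetric]; measurable)
  also have "\<dots> = distr (distr M ?P ?R \<Otimes>\<^sub>M F) borel (\<lambda>(x, y). max (?J x - y) 0)"
    by (subst distr_past_next) auto
  also have "\<dots> = distr (distr (distr M ?P ?R \<Otimes>\<^sub>M F) (borel \<Otimes>\<^sub>M F) (\<lambda>(x, y). (?J x, y))) borel
      (\<lambda>(s, y). max (s - y) 0)"
    by (subst distr_distr) (auto simp: comp_def split_beta')
  also have "distr (distr M ?P ?R \<Otimes>\<^sub>M F) (borel \<Otimes>\<^sub>M F) (\<lambda>(x, y). (?J x, y)) =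
      distr (distr M ?P ?R) borel ?J \<Otimes>\<^sub>M distr F F (\<lambda>y. y)"
    by (rule pair_measure_distr[symmetric]) (auto simp: distr_id intro: walk.sigma_finite_measure_axioms)
  finally show ?case by (simp add: J distr_id)
qed

lemma steady_state_law_eq: "steady_state_law M Dt r = interval_measure walk.stationary_cdf"
proof -
  have "inventory Dt r t \<in> borel_measurable M" for t by (induction t) auto
  then have "measure M {\<omega> \<in> space M. inventory Dt r t \<omega> \<le> x} = cdf (lindley F t) x" for t x
    unfolding distr_inventory[symmetric] cdf_def
    by (subst measure_distr) (auto intro!: arg_cong[where f = prob])
  then show ?thesis unfolding steady_state_law_def walk.stationary_cdf_def by simp
qed

section \<open>The first weak ascending ladder epoch\<close>

abbreviation S :: "nat \<Rightarrow> 'a \<Rightarrow> real" where "S \<equiv> partial_sum Dt r"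

text \<open>The event that the ladder period exceeds n; it is certain for n = 0.\<close>

definition below :: "nat \<Rightarrow> 'a \<Rightarrow> bool" where
  "below n \<omega> \<longleftrightarrow> (\<forall>k\<in>{1..n}. S k \<omega> < 0)"

lemma S_Suc: "S (Suc n) \<omega> = S n \<omega> + (Dt (Suc n) \<omega> - r)"
  by (simp add: partial_sum_def)

lemma S_measurable [measurable]: "S n \<in> borel_measurable M"
  unfolding partial_sum_def by measurable

lemma below_measurable [measurable]: "Measurable.pred M (below n)"
  unfolding below_def by measurable

text \<open>The premise is the induction hypothesis of \<open>nn_integral_below\<close>. Leaving the
  new position unrestricted lets one step serve both survival, with \<open>{..<0}\<close>, and
  ladder heights, with \<open>{0..}\<close>.\<close>

lemma nn_integral_walk_step:
  assumes V: "\<And>f. f \<in> borel_measurable borel \<Longrightarrow>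
      (\<integral>\<^sup>+\<omega>. f (S n \<omega>) * indicator {\<omega>. below n \<omega>} \<omega> \<partial>M) = (\<integral>\<^sup>+t. f t \<partial>killed_law F {..<0} n)"
    and [measurable]: "f \<in> borel_measurable borel"
  shows "(\<integral>\<^sup>+\<omega>. f (S (Suc n) \<omega>) * indicator {\<omega>. below n \<omega>} \<omega> \<partial>M) =
    (\<integral>\<^sup>+t. \<integral>\<^sup>+y. f (t + y) \<partial>F \<partial>killed_law F {..<0} n)"
proof -
  let ?R = "\<lambda>\<omega>. restrict (\<lambda>i. Dt i \<omega>) {1..n}"
  let ?P = "PiM {1..n} (\<lambda>_. borel :: real measure)"
  define s where "s k x = (\<Sum>i=1..k. x i - r)" for k and x :: "nat \<Rightarrow> real"
  define b where "b x \<longleftrightarrow> (\<forall>k\<in>{1..n}. s k x < 0)" for x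
  have sm: "s k \<in> borel_measurable ?P" if "k \<le> n" for k
    unfolding s_def using that by (auto intro!: borel_measurable_sum borel_measurable_diff)
  then have [measurable]: "s n \<in> borel_measurable ?P" by simp
  have [measurable]: "Measurable.pred ?P b"
    unfolding b_def by (intro pred_intros_finite borel_measurable_pred_less sm) auto
  have s: "s k (?R \<omega>) = S k \<omega>" if "k \<le> n" for k \<omega>
    using that by (auto simp: s_def partial_sum_def intro!: sum.cong)
  then have b: "b (?R \<omega>) \<longleftrightarrow> below n \<omega>" for \<omega>
    by (auto simp: b_def below_def)
  interpret R: prob_space "distr M ?P ?R" by (rule prob_space_distr) measurable
  have meas: "(\<lambda>(x, y). f (s n x + y) * of_bool (b x)) \<in> borel_measurable (distr M ?P ?R \<Otimes>\<^sub>M F)"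
    by (subst measurable_cong_sets[OF sets_pair_measure_cong[OF sets_distr walk.events_eq_borel] refl])
      measurable
  have "(\<integral>\<^sup>+\<omega>. f (S (Suc n) \<omega>) * indicator {\<omega>. below n \<omega>} \<omega> \<partial>M) =
    (\<integral>\<^sup>+\<omega>. (\<lambda>(x, y). f (s n x + y) * of_bool (b x)) (?R \<omega>, Dt (Suc n) \<omega> - r) \<partial>M)"
    by (intro nn_integral_cong) (auto simp: S_Suc s b indicator_def simp del: One_nat_def)
  also have "\<dots> = (\<integral>\<^sup>+z. (\<lambda>(x, y). f (s n x + y) * of_bool (b x)) z
      \<partial>distr M (?P \<Otimes>\<^sub>M borel) (\<lambda>\<omega>. (?R \<omega>, Dt (Suc n) \<omega> - r)))"
    by (rule nn_integral_distr[symmetric]) measurable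
  also have "\<dots> = (\<integral>\<^sup>+z. (\<lambda>(x, y). f (s n x + y) * of_bool (b x)) z \<partial>(distr M ?P ?R \<Otimes>\<^sub>M F))"
    by (subst distr_past_next) auto
  also have "\<dots> = (\<integral>\<^sup>+x. \<integral>\<^sup>+y. f (s n x + y) * of_bool (b x) \<partial>F \<partial>distr M ?P ?R)"
    by (subst walk.nn_integral_fst[OF meas, symmetric]) simp
  also have "\<dots> = (\<integral>\<^sup>+\<omega>. \<integral>\<^sup>+y. f (s n (?R \<omega>) + y) * of_bool (b (?R \<omega>)) \<partial>F \<partial>M)"
    by (rule nn_integral_distr) measurable
  also have "\<dots> = (\<integral>\<^sup>+\<omega>. (\<integral>\<^sup>+y. f (S n \<omega> + y) \<partial>F) * indicator {\<omega>. below n \<omega>} \<omega> \<partial>M)"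
    by (intro nn_integral_cong) (auto simp: s b indicator_def simp del: One_nat_def)
  also have "\<dots> = (\<integral>\<^sup>+t. \<integral>\<^sup>+y. f (t + y) \<partial>F \<partial>killed_law F {..<0} n)"
    by (rule V) measurable
  finally show ?thesis .
qed

lemma nn_integral_below:
  "f \<in> borel_measurable borel \<Longrightarrow>
    (\<integral>\<^sup>+\<omega>. f (S n \<omega>) * indicator {\<omega>. below n \<omega>} \<omega> \<partial>M) = (\<integral>\<^sup>+t. f t \<partial>killed_law F {..<0} n)"
proof (induction n arbitrary: f)
  case 0
  then show ?case
    by (simp add: below_def partial_sum_def nn_integral_return emeasure_space_1)
next
  case (Suc n)
  note [measurable] = Suc.prems
  have "below (Suc n) \<omega> \<longleftrightarrow> below n \<omega> \<and> S (Suc n) \<omega> < 0" for \<omega>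
    by (auto simp: below_def atLeastAtMostSuc_conv)
  then have "(\<integral>\<^sup>+\<omega>. f (S (Suc n) \<omega>) * indicator {\<omega>. below (Suc n) \<omega>} \<omega> \<partial>M) =
    (\<integral>\<^sup>+\<omega>. (\<lambda>s. f s * indicator {..<0} s) (S (Suc n) \<omega>) * indicator {\<omega>. below n \<omega>} \<omega> \<partial>M)"
    by (intro nn_integral_cong) (auto simp: indicator_def)
  also have "\<dots> = (\<integral>\<^sup>+t. f t \<partial>killed_law F {..<0} (Suc n))"
    by (subst nn_integral_walk_step[OF Suc.IH]) (auto simp: walk.nn_integral_killed_law_Suc simp del: killed_law.simps)
  finally show ?case .
qed

text \<open>On positions t \<le> 0 the weight exp(-\<epsilon> t) is at least 1, so the probability
  that the ladder period exceeds n decays geometrically.\<close>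

lemma AE_ladder_period: "AE \<omega> in M. \<exists>n. \<not> below n \<omega>"
proof -
  obtain \<epsilon> where e: "0 < \<epsilon>" "walk.laplace \<epsilon> < 1" using walk.laplace_lt_1[of 1] by auto
  have le: "prob {\<omega> \<in> space M. \<forall>n. below n \<omega>} \<le> walk.laplace \<epsilon> ^ n" for n
  proof -
    have "emeasure M {\<omega> \<in> space M. \<forall>n. below n \<omega>} \<le> emeasure M {\<omega> \<in> space M. below n \<omega>}"
      by (intro emeasure_mono) auto
    also have "\<dots> = (\<integral>\<^sup>+\<omega>. indicator {\<omega> \<in> space M. below n \<omega>} \<omega> \<partial>M)" by simp
    also have "\<dots> = (\<integral>\<^sup>+\<omega>. 1 * indicator {\<omega>. below n \<omega>} \<omega> \<partial>M)"
      by (intro nn_integral_cong) (auto simp: indicator_def)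
    also have "\<dots> = (\<integral>\<^sup>+t. 1 \<partial>killed_law F {..<0} n)"
      by (rule nn_integral_below) simp
    also have "\<dots> \<le> (\<integral>\<^sup>+t. ennreal (exp (- \<epsilon> * t)) \<partial>killed_law F {..<0} n)"
      by (rule nn_integral_mono_AE, rule eventually_mono[OF walk.AE_neg])
        (use e in \<open>auto simp: mult_nonneg_nonpos simp flip: ennreal_1 intro!: ennreal_leI\<close>)
    also have "\<dots> \<le> ennreal (walk.laplace \<epsilon> ^ n)"
      using e by (intro walk.killed_law_laplace) auto
    finally show ?thesis by (simp add: emeasure_eq_measure walk.laplace_nonneg)
  qed
  have "(\<lambda>n. walk.laplace \<epsilon> ^ n) \<longlonglongrightarrow> 0"
    using e walk.laplace_nonneg[of \<epsilon>] by (intro LIMSEQ_realpow_zero) auto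
  then have "prob {\<omega> \<in> space M. \<forall>n. below n \<omega>} \<le> 0"
    by (rule LIMSEQ_le_const) (use le in blast)
  then have "prob {\<omega> \<in> space M. \<forall>n. below n \<omega>} = 0"
    by (simp add: measure_le_0_iff)
  then show ?thesis
    by (intro AE_I[of _ _ "{\<omega> \<in> space M. \<forall>n. below n \<omega>}"]) (auto simp: emeasure_eq_measure)
qed

lemma ladder_height_measurable [measurable]: "ladder_height Dt r \<in> borel_measurable M"
proof -
  have [measurable]: "ladder_period Dt r \<in> measurable M (count_space UNIV)"
    unfolding ladder_period_def[abs_def] Inf_nat_def by measurable
  show ?thesis
    unfolding ladder_height_def[abs_def]
    by (rule measurable_compose_countable) measurable
qed

text \<open>Exactly one term survives, the one whose n + 1 is the ladder period. The premise
  excludes the null event on which the infimum is taken over the empty set.\<close>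

lemma suminf_ladder_height:
  fixes f :: "real \<Rightarrow> ennreal"
  assumes "\<exists>n. \<not> below n \<omega>"
  shows "(\<Sum>n. f (S (Suc n) \<omega>) * indicator {0..} (S (Suc n) \<omega>) * indicator {\<omega>. below n \<omega>} \<omega>) =
    f (ladder_height Dt r \<omega>)"
proof -
  define T where "T = {t. 0 < t \<and> 0 \<le> S t \<omega>}"
  obtain n i where "i \<in> {1..n}" "\<not> S i \<omega> < 0" using assms unfolding below_def by blast
  then have "i \<in> T" by (simp add: T_def)
  then have ne: "T \<noteq> {}" by blast
  define m where "m = ladder_period Dt r \<omega>"
  have m: "m \<in> T" unfolding m_def ladder_period_def T_def[symmetric] by (rule Inf_nat_def1[OF ne])
  have less: "t \<notin> T" if "t < m" for t
    using that wellorder_Inf_le1[of t T] unfolding m_def ladder_period_def T_def[symmetric] by (meson not_le)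
  obtain k where k: "m = Suc k" using m by (cases m) (auto simp: T_def)
  have "0 \<le> S (Suc n) \<omega> \<and> below n \<omega> \<longleftrightarrow> n = k" for n
  proof
    assume n: "0 \<le> S (Suc n) \<omega> \<and> below n \<omega>"
    have "\<not> n < k" using n less[of "Suc n"] by (auto simp: T_def k)
    moreover have "\<not> k < n"
    proof
      assume "k < n"
      then have "S m \<omega> < 0" using n by (auto simp: below_def k)
      then show False using m by (simp add: T_def)
    qed
    ultimately show "n = k" by simp
  next
    assume "n = k"
    moreover have "S t \<omega> < 0" if "t \<in> {1..k}" for t
      using less[of t] that by (auto simp: T_def k)
    ultimately show "0 \<le> S (Suc n) \<omega> \<and> below n \<omega>"
      using m by (auto simp: T_def k below_def)
  qed
  then have "f (S (Suc n) \<omega>) * indicator {0..} (S (Suc n) \<omega>) * indicator {\<omega>. below n \<omega>} \<omega> =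
      (if n = k then f (S (Suc k) \<omega>) else 0)" for n
    by (auto simp: indicator_def)
  then have "(\<Sum>n. f (S (Suc n) \<omega>) * indicator {0..} (S (Suc n) \<omega>) * indicator {\<omega>. below n \<omega>} \<omega>) =
      f (S (Suc k) \<omega>)"
    using suminf_finite[of "{k}" "\<lambda>n. if n = k then f (S (Suc k) \<omega>) else 0"] by simp
  then show ?thesis by (simp add: ladder_height_def m_def[symmetric] k)
qed

lemma ladder_ladder_height_law: "ladder F r (ladder_height_law M Dt r)"
proof
  show "sets (ladder_height_law M Dt r) = sets borel"
    by (simp add: ladder_height_law_def)
  fix f :: "real \<Rightarrow> ennreal" assume [measurable]: "f \<in> borel_measurable borel"
  have "(\<integral>\<^sup>+z. f z \<partial>ladder_height_law M Dt r) = (\<integral>\<^sup>+\<omega>. f (ladder_height Dt r \<omega>) \<partial>M)"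
    unfolding ladder_height_law_def by (rule nn_integral_distr) measurable
  also have "\<dots> = (\<integral>\<^sup>+\<omega>. (\<Sum>n. f (S (Suc n) \<omega>) * indicator {0..} (S (Suc n) \<omega>) * indicator {\<omega>. below n \<omega>} \<omega>) \<partial>M)"
    by (rule nn_integral_cong_AE, rule eventually_mono[OF AE_ladder_period]) (rule suminf_ladder_height[symmetric])
  also have "\<dots> = (\<Sum>n. \<integral>\<^sup>+\<omega>. f (S (Suc n) \<omega>) * indicator {0..} (S (Suc n) \<omega>) * indicator {\<omega>. below n \<omega>} \<omega> \<partial>M)"
    by (rule nn_integral_suminf) measurable
  also have "\<dots> = (\<Sum>n. \<integral>\<^sup>+t. \<integral>\<^sup>+y. f (t + y) * indicator {0..} (t + y) \<partial>F \<partial>killed_law F {..<0} n)"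
    using nn_integral_walk_step[OF nn_integral_below, of "\<lambda>s. f s * indicator {0..} s"] by simp
  finally show "(\<integral>\<^sup>+z. f z \<partial>ladder_height_law M Dt r) =
    (\<Sum>n. \<integral>\<^sup>+t. \<integral>\<^sup>+y. f (t + y) * indicator {0..} (t + y) \<partial>F \<partial>killed_law F {..<0} n)" .
qed

end

theorem theorem2:
  fixes M :: "'a measure" and D :: "'a \<Rightarrow> real" and Dt :: "nat \<Rightarrow> 'a \<Rightarrow> real"
    and h p r :: real and v :: "real \<Rightarrow> real"
  assumes "prob_space M"
    and "D \<in> borel_measurable M"
    and "AE \<omega> in M. 0 \<le> D \<omega>"
    and "cdf (distr M borel D) 0 = 0"
    and "integrable M D"
    and "integrable M (\<lambda>\<omega>. (D \<omega>)\<^sup>2)"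
    and "0 < prob_space.variance M D"
    and "prob_space.indep_vars M (\<lambda>_. borel) Dt UNIV"
    and "\<And>t. distr M borel (Dt t) = distr M borel D"
    and "0 \<le> h" and "0 \<le> p"
    and "0 \<le> r" and "r < prob_space.expectation M D"
  shows "solves_relative_value_equation M D Dt h p r v \<and> subexponential v \<longleftrightarrow>
    (\<forall>x\<ge>0. v x =
       h * prob_space.expectation M (ladder_height Dt r) / (prob_space.expectation M D - r)
         * (LINT y:{0..x}|lborel. renewal_function M Dt r y)
       - (h + p) * x)"
proof -
  interpret M: prob_space M by fact
  note [measurable] = assms(2)
  define F where "F = net_demand_law M D r"
  have mean: "(\<integral>y. y \<partial>F) = M.expectation D - r"
    unfolding F_def net_demand_law_def using assms(5) by (simp add: integral_distr M.prob_space)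
  interpret F: prob_space F
    unfolding F_def net_demand_law_def by (rule M.prob_space_distr) measurable
  interpret net_demand F r
  proof
    show "sets F = sets borel" by (simp add: F_def net_demand_law_def)
    show "0 \<le> r" by fact
    show "AE y in F. - r \<le> y"
      unfolding F_def net_demand_law_def using assms(3) by (subst AE_distr_iff) auto
    show "integrable F (\<lambda>y. y)"
      unfolding F_def net_demand_law_def using assms(5) by (subst integrable_distr_eq) auto
    show "integrable F (\<lambda>y. y\<^sup>2)"
      unfolding F_def net_demand_law_def using assms(5,6)
      by (subst integrable_distr_eq) (auto simp: power2_diff)
    show "0 < (\<integral>y. y \<partial>F)" using mean assms(13) by simp
  qed
  interpret P: demand_process M F r Dt
  proof
    show "M.indep_vars (\<lambda>_. borel) Dt UNIV" by fact
    fix t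
    have [measurable]: "Dt t \<in> borel_measurable M"
      using assms(8) by (auto simp: M.indep_vars_def)
    have "distr M borel (\<lambda>\<omega>. Dt t \<omega> - r) = distr (distr M borel (Dt t)) borel (\<lambda>x. x - r)"
      by (subst distr_distr) (auto simp: comp_def)
    also have "\<dots> = F"
      unfolding assms(9) F_def net_demand_law_def by (subst distr_distr) (auto simp: comp_def)
    finally show "distr M borel (\<lambda>\<omega>. Dt t \<omega> - r) = F" .
  qed
  interpret ladder F r "ladder_height_law M Dt r" by (rule P.ladder_ladder_height_law)
  have cost: "relative_cost M D Dt h p r x = h * (\<integral>y. max (x - y) 0 \<partial>F) + p * (\<integral>y. max (y - x) 0 \<partial>F)
      - p * (\<integral>y. y \<partial>F) - h * (\<integral>s. s \<partial>interval_measure stationary_cdf)" for x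
    unfolding relative_cost_def F_def[symmetric] P.steady_state_law_eq ..
  have "(\<integral>z. z \<partial>ladder_height_law M Dt r) = M.expectation (ladder_height Dt r)"
    unfolding ladder_height_law_def by (rule integral_distr[OF P.ladder_height_measurable]) simp
  then have vf: "h * M.expectation (ladder_height Dt r) / (M.expectation D - r)
         * (LINT y:{0..x}|lborel. renewal_function M Dt r y) - (h + p) * x = value_function h p x" for x
    by (simp add: value_function_def integrated_renewal_def renewal_function_def
        suminf_cdf_convolution_power mu_def mean)
  \<comment> \<open>Values of \<open>v\<close> at negative arguments never enter, since y \<le> x on
    the domain of integration.\<close>
  have cong: "set_integrable F {- r..x} (\<lambda>y. v (x - y)) \<longleftrightarrow>
      set_integrable F {- r..x} (\<lambda>y. value_function h p (x - y))"
    "(LINT y:{- r..x}|F. v (x - y)) = (LINT y:{- r..x}|F. value_function h p (x - y))"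
    if "\<forall>x\<ge>0. v x = value_function h p x" for x
    using that unfolding set_integrable_def set_lebesgue_integral_def
    by (auto intro!: Bochner_Integration.integrable_cong Bochner_Integration.integral_cong simp: indicator_def)
  show ?thesis
    unfolding vf
  proof
    assume *: "\<forall>x\<ge>0. v x = value_function h p x"
    have "v 0 = 0"
      using * by (simp add: value_function_def integrated_renewal_nonpos)
    then have "solves_relative_value_equation M D Dt h p r v"
      unfolding solves_relative_value_equation_def F_def[symmetric] cost cong[OF *]
      using * value_function_solves[of _ h p] by simp
    moreover have "subexponential v"
      using subexponential_value_function[of h p] * by (simp add: subexponential_def)
    ultimately show "solves_relative_value_equation M D Dt h p r v \<and> subexponential v" by simp
  next
    assume "solves_relative_value_equation M D Dt h p r v \<and> subexponential v"
    then have sol: "solves_relative_value_equation M D Dt h p r v" and sub: "subexponential v"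
      by simp_all
    have v: "set_integrable F {- r..x} (\<lambda>y. v (x - y))"
      "v x = relative_cost M D Dt h p r x + (LINT y:{- r..x}|F. v (x - y))" if "0 \<le> x" for x
      using that sol unfolding solves_relative_value_equation_def F_def[symmetric] by blast+
    obtain \<epsilon> where e: "0 < \<epsilon>" "laplace \<epsilon> < 1" using laplace_lt_1[of 1] by auto
    obtain K1 where K1: "\<And>x. 0 \<le> x \<Longrightarrow> \<bar>v x\<bar> \<le> K1 * exp (\<epsilon> * x)"
      using sub e unfolding subexponential_def by blast
    obtain K2 where K2: "\<And>x. 0 \<le> x \<Longrightarrow> \<bar>value_function h p x\<bar> \<le> K2 * exp (\<epsilon> * x)"
      using subexponential_value_function[of h p] e unfolding subexponential_def by blast
    \<comment> \<open>The cost term cancels in the difference, which thus solves the homogeneous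
      equation; one \<epsilon> serves both growth bounds and the contraction.\<close>
    have "v x - value_function h p x = 0" if "0 \<le> x" for x
    proof (rule homogeneous_solution_zero[of "\<lambda>x. v x - value_function h p x" "K1 + K2" \<epsilon>])
      fix x :: real assume x: "0 \<le> x"
      show "set_integrable F {- r..x} (\<lambda>y. v (x - y) - value_function h p (x - y))"
        by (intro set_integral_diff v value_function_solves x)
      show "v x - value_function h p x = (LINT y:{- r..x}|F. v (x - y) - value_function h p (x - y))"
        using v[OF x] value_function_solves[OF x, of h p]
        by (simp add: set_integral_diff cost)
      show "\<bar>v x - value_function h p x\<bar> \<le> (K1 + K2) * exp (\<epsilon> * x)"
        using K1[OF x] K2[OF x] by (simp add: distrib_right)
    qed (use e that in auto)
    then show "\<forall>x\<ge>0. v x = value_function h p x" by simp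
  qed
qed

end
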